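(* Let $\mu_2\in\mathbb{R}$, $\zeta\in\{0,1\}$ and $\theta\in\{\mathrm{a}_{12},\mathrm{mix}\}$. If $\mu_2\in\mathcal{B}_\zeta^{-}$ (resp. $\mu_2\in\mathcal{B}_\zeta^{+}$), then $H^{\theta}_{\mu_2}(0)$ has exactly $\zeta$ eigenvalues lying strictly below (resp. above) its essential spectrum $[0,24]$. Each such eigenvalue $z=z(\mu_2)$ admits an eigenfunction of the form $$f^{\theta}_{\mu_2}(p)=-\frac{\mu_2\,c\,\alpha^{\theta}_3(p)}{\mathcal{E}_0(p)-z},$$ where $c$ is a normalization constant.
   Context: $\mathbb{T}^3=(\mathbb{R}/2\pi\mathbb{Z})^3$; $L^{2,\mathrm{e}}(\mathbb{T}^3)$ is the Hilbert space of even functions in $L^2(\mathbb{T}^3)$. $\mathcal{E}_0(p)=4\sum_{i=1}^3(1-\cos p_i)$ and $(H_0(0)f)(p)=\mathcal{E}_0(p)f(p)$. $L^{2,\mathrm{e,a_{12}}}(\mathbb{T}^3)$ consists of the $f\in L^{2,\mathrm{e}}$ with $f(p_1,p_2,p_3)=-f(p_2,p_1,p_3)$; $L^{2,\mathrm{e,mix}}(\mathbb{T}^3)$ consists of the $f\in L^{2,\mathrm{e}}$ with $f(p_1,p_2,p_3)=f(p_2,p_1,p_3)$ and $f=f_1+f_2$ for some $f_1,f_2\in L^{2,\mathrm{e}}$ with $f_1(p_1,p_2,p_3)=-f_1(p_3,p_2,p_1)$, $f_2(p_1,p_2,p_3)=-f_2(p_1,p_3,p_2)$. Set $$\alpha^{\mathrm{a_{12}}}_3(p)=\frac{\cos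 p_1-\cos p_2}{\sqrt{8\pi^3}},\qquad \alpha^{\mathrm{mix}}_3(p)=\frac{\cos p_1+\cos p_2-2\cos p_3}{\sqrt{24\pi^3}}.$$ For $\theta\in\{\mathrm{a_{12}},\mathrm{mix}\}$, $H^\theta_{\mu_2}(0)=H_0(0)+\mu_2(\cdot,\alpha^\theta_3)\alpha^\theta_3$ acting in $L^{2,\mathrm{e},\theta}(\mathbb{T}^3)$. Let $a(0)=\int_{\mathbb{T}^3}\frac{(\alpha^\theta_3(p))^2}{\mathcal{E}_0(p)}\,dp$ (finite, positive and the same for both $\theta$) and $\mu_2^{(0)}=1/a(0)$. The intervals are $\mathcal{B}_0^-=\{\mu_2>-\mu_2^{(0)}\}$, $\mathcal{B}_1^-=\{\mu_2<-\mu_2^{(0)}\}$, $\mathcal{B}_0^+=\{\mu_2<\mu_2^{(0)}\}$, $\mathcal{B}_1^+=\{\mu_2>\mu_2^{(0)}\}$. *)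

theory Defs
  imports "HOL-Analysis.Analysis"
begin

section \<open>The Hilbert space of square-integrable functions on the torus\<close>

text \<open>
  Functions on the torus are functions on \<open>\<real>\<^sup>3\<close> that are \<open>2\<pi>\<close>-periodic in each coordinate, and
  integrals over the torus are integrals over the fundamental cube. Elements of the \<open>L\<^sup>2\<close> spaces
  are represented by complex-valued functions; all notions below are insensitive to changes on
  null sets, equality of elements being equality almost everywhere.
\<close>

definition T3 :: "(real^3) measure" where
  "T3 = restrict_space lborel (cbox (\<chi> i. - pi) (\<chi> i. pi))"

definition L2 :: "(real^3 \<Rightarrow> complex) set" where
  "L2 = {f. f \<in> borel_measurable borel \<and>
            (\<forall>p i. f (p + axis i (2 * pi)) = f p) \<and>
            integrable T3 (\<lambda>p. (cmod (f p))\<^sup>2)}"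

definition ae_eq :: "(real^3 \<Rightarrow> complex) \<Rightarrow> (real^3 \<Rightarrow> complex) \<Rightarrow> bool"
    (infix \<open>=\<^sub>a\<^sub>e\<close> 50) where
  "f =\<^sub>a\<^sub>e g \<longleftrightarrow> (AE p in T3. f p = g p)"

definition inner_L2 :: "(real^3 \<Rightarrow> complex) \<Rightarrow> (real^3 \<Rightarrow> complex) \<Rightarrow> complex" where
  "inner_L2 f g = (LINT p|T3. f p * cnj (g p))"

definition norm_L2 :: "(real^3 \<Rightarrow> complex) \<Rightarrow> real" where
  "norm_L2 f = sqrt (LINT p|T3. (cmod (f p))\<^sup>2)"

definition L2_e :: "(real^3 \<Rightarrow> complex) set" where
  "L2_e = {f \<in> L2. (\<lambda>p. f (- p)) =\<^sub>a\<^sub>e f}"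

definition L2_e_a12 :: "(real^3 \<Rightarrow> complex) set" where
  "L2_e_a12 = {f \<in> L2_e. f =\<^sub>a\<^sub>e (\<lambda>p. - f (vector [p$2, p$1, p$3]))}"

definition L2_e_mix :: "(real^3 \<Rightarrow> complex) set" where
  "L2_e_mix = {f \<in> L2_e. f =\<^sub>a\<^sub>e (\<lambda>p. f (vector [p$2, p$1, p$3])) \<and>
     (\<exists>f1\<in>L2_e. \<exists>f2\<in>L2_e. f =\<^sub>a\<^sub>e (\<lambda>p. f1 p + f2 p) \<and>
        f1 =\<^sub>a\<^sub>e (\<lambda>p. - f1 (vector [p$3, p$2, p$1])) \<and>
        f2 =\<^sub>a\<^sub>e (\<lambda>p. - f2 (vector [p$1, p$3, p$2])))}"


section \<open>Spectral notions\<close>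

text \<open>
  In this section \<open>V\<close> is a closed subspace of \<open>L\<^sup>2\<close> and \<open>A\<close> is a bounded self-adjoint operator
  mapping \<open>V\<close> to itself, both given on representatives.
\<close>

definition eigenspace ::
  "(real^3 \<Rightarrow> complex) set \<Rightarrow> ((real^3 \<Rightarrow> complex) \<Rightarrow> (real^3 \<Rightarrow> complex)) \<Rightarrow> complex
    \<Rightarrow> (real^3 \<Rightarrow> complex) set" where
  "eigenspace V A z = {f \<in> V. A f =\<^sub>a\<^sub>e (\<lambda>p. z * f p)}"

definition eigenfunction ::
  "(real^3 \<Rightarrow> complex) set \<Rightarrow> ((real^3 \<Rightarrow> complex) \<Rightarrow> (real^3 \<Rightarrow> complex)) \<Rightarrow> complex
    \<Rightarrow> (real^3 \<Rightarrow> complex) \<Rightarrow> bool" where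
  "eigenfunction V A z f \<longleftrightarrow> f \<in> eigenspace V A z \<and> \<not> f =\<^sub>a\<^sub>e (\<lambda>p. 0)"

definition eigenvalue ::
  "(real^3 \<Rightarrow> complex) set \<Rightarrow> ((real^3 \<Rightarrow> complex) \<Rightarrow> (real^3 \<Rightarrow> complex)) \<Rightarrow> complex \<Rightarrow> bool"
  where "eigenvalue V A z \<longleftrightarrow> (\<exists>f. eigenfunction V A z f)"

text \<open>Dimension of a subspace \<open>W\<close> modulo almost-everywhere equality: \<open>W\<close> has a basis of size \<open>n\<close>.\<close>

definition has_dim :: "(real^3 \<Rightarrow> complex) set \<Rightarrow> nat \<Rightarrow> bool" where
  "has_dim W n \<longleftrightarrow> (\<exists>b :: nat \<Rightarrow> real^3 \<Rightarrow> complex.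
     (\<forall>i<n. b i \<in> W) \<and>
     (\<forall>f\<in>W. \<exists>c :: nat \<Rightarrow> complex. f =\<^sub>a\<^sub>e (\<lambda>p. \<Sum>i<n. c i * b i p)) \<and>
     (\<forall>c :: nat \<Rightarrow> complex. (\<lambda>p. \<Sum>i<n. c i * b i p) =\<^sub>a\<^sub>e (\<lambda>p. 0) \<longrightarrow> (\<forall>i<n. c i = 0)))"

text \<open>
  \<open>z\<close> is in the resolvent set if \<open>A - z\<close> is a bijection of \<open>V\<close> with bounded inverse; the norm
  estimate expresses injectivity together with boundedness of the inverse.
\<close>

definition resolvent_set ::
  "(real^3 \<Rightarrow> complex) set \<Rightarrow> ((real^3 \<Rightarrow> complex) \<Rightarrow> (real^3 \<Rightarrow> complex)) \<Rightarrow> complex set" where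
  "resolvent_set V A = {z.
     (\<forall>g\<in>V. \<exists>f\<in>V. (\<lambda>p. A f p - z * f p) =\<^sub>a\<^sub>e g) \<and>
     (\<exists>C. \<forall>f\<in>V. norm_L2 f \<le> C * norm_L2 (\<lambda>p. A f p - z * f p))}"

definition op_spectrum ::
  "(real^3 \<Rightarrow> complex) set \<Rightarrow> ((real^3 \<Rightarrow> complex) \<Rightarrow> (real^3 \<Rightarrow> complex)) \<Rightarrow> complex set" where
  "op_spectrum V A = - resolvent_set V A"

text \<open>
  Isolated eigenvalues of finite multiplicity; as \<open>A\<close> is self-adjoint, geometric and algebraic
  multiplicity agree.
\<close>

definition discrete_spectrum ::
  "(real^3 \<Rightarrow> complex) set \<Rightarrow> ((real^3 \<Rightarrow> complex) \<Rightarrow> (real^3 \<Rightarrow> complex)) \<Rightarrow> complex set" where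
  "discrete_spectrum V A = {z \<in> op_spectrum V A. \<not> z islimpt op_spectrum V A \<and>
     eigenvalue V A z \<and> (\<exists>n. has_dim (eigenspace V A z) n)}"

definition essential_spectrum ::
  "(real^3 \<Rightarrow> complex) set \<Rightarrow> ((real^3 \<Rightarrow> complex) \<Rightarrow> (real^3 \<Rightarrow> complex)) \<Rightarrow> complex set" where
  "essential_spectrum V A = op_spectrum V A - discrete_spectrum V A"

definition eigenvalues_below ::
  "(real^3 \<Rightarrow> complex) set \<Rightarrow> ((real^3 \<Rightarrow> complex) \<Rightarrow> (real^3 \<Rightarrow> complex)) \<Rightarrow> real set" where
  "eigenvalues_below V A =
     {z. eigenvalue V A (of_real z) \<and> (\<forall>w\<in>essential_spectrum V A. z < Re w)}"

definition eigenvalues_above ::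
  "(real^3 \<Rightarrow> complex) set \<Rightarrow> ((real^3 \<Rightarrow> complex) \<Rightarrow> (real^3 \<Rightarrow> complex)) \<Rightarrow> real set" where
  "eigenvalues_above V A =
     {z. eigenvalue V A (of_real z) \<and> (\<forall>w\<in>essential_spectrum V A. Re w < z)}"


section \<open>The operators\<close>

datatype symmetry = A12 | Mix

fun L2_sym :: "symmetry \<Rightarrow> (real^3 \<Rightarrow> complex) set" where
  "L2_sym A12 = L2_e_a12"
| "L2_sym Mix = L2_e_mix"

definition E0 :: "real^3 \<Rightarrow> real" where
  "E0 p = 4 * (\<Sum>i\<in>UNIV. 1 - cos (p$i))"

fun alpha3 :: "symmetry \<Rightarrow> real^3 \<Rightarrow> real" where
  "alpha3 A12 p = (cos (p$1) - cos (p$2)) / sqrt (8 * pi ^ 3)"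
| "alpha3 Mix p = (cos (p$1) + cos (p$2) - 2 * cos (p$3)) / sqrt (24 * pi ^ 3)"

definition H0 :: "(real^3 \<Rightarrow> complex) \<Rightarrow> (real^3 \<Rightarrow> complex)" where
  "H0 f = (\<lambda>p. of_real (E0 p) * f p)"

definition H :: "symmetry \<Rightarrow> real \<Rightarrow> (real^3 \<Rightarrow> complex) \<Rightarrow> (real^3 \<Rightarrow> complex)" where
  "H \<theta> \<mu> f = (\<lambda>p. H0 f p +
     of_real \<mu> * inner_L2 f (\<lambda>q. of_real (alpha3 \<theta> q)) * of_real (alpha3 \<theta> p))"

text \<open>
  \<open>E0\<close> vanishes in the cube only at \<open>p = 0\<close>, a null set; elsewhere the integrand is bounded. The value
  of \<open>a0\<close> does not depend on \<open>\<theta>\<close>, by permutation invariance of \<open>E0\<close>.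
\<close>

definition a0 :: "symmetry \<Rightarrow> real" where
  "a0 \<theta> = (LINT p|T3. (alpha3 \<theta> p)\<^sup>2 / E0 p)"

definition mu20 :: "symmetry \<Rightarrow> real" where
  "mu20 \<theta> = 1 / a0 \<theta>"

text \<open>Used only for the indices \<open>0\<close> and \<open>1\<close>.\<close>

definition B_minus :: "symmetry \<Rightarrow> nat \<Rightarrow> real set" where
  "B_minus \<theta> \<zeta> = (if \<zeta> = 0 then {\<mu>. \<mu> > - mu20 \<theta>} else {\<mu>. \<mu> < - mu20 \<theta>})"

definition B_plus :: "symmetry \<Rightarrow> nat \<Rightarrow> real set" where
  "B_plus \<theta> \<zeta> = (if \<zeta> = 0 then {\<mu>. \<mu> < mu20 \<theta>} else {\<mu>. \<mu> > mu20 \<theta>})"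

definition eigenfun :: "symmetry \<Rightarrow> real \<Rightarrow> real \<Rightarrow> complex \<Rightarrow> real^3 \<Rightarrow> complex" where
  "eigenfun \<theta> \<mu> z c = (\<lambda>p. - (of_real \<mu> * c * of_real (alpha3 \<theta> p)) / of_real (E0 p - z))"

end

theory Submission
  imports Defs
begin

text \<open>
  \<open>H\<close> is multiplication by \<open>E0\<close> plus a rank one perturbation, so off \<open>[0,24]\<close> its resolvent is explicit and
  exists unless \<open>1 + \<mu> F(z) = 0\<close>, where \<open>F(z)\<close> is the integral of \<open>\<alpha>\<^sub>3\<^sup>2 / (E0 - z)\<close>; at a zero, \<open>\<alpha>\<^sub>3 / (E0 - z)\<close>
  spans the eigenspace. Zeros are real since \<open>Im F(z)\<close> is a nonzero multiple of \<open>Im z\<close>. On each real half line off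
  \<open>[0,24]\<close>, \<open>\<bar>F\<bar>\<close> decreases strictly with the distance \<open>t\<close> to \<open>[0,24]\<close>, tends to \<open>0\<close> at infinity and, because
  \<open>\<bar>\<alpha>\<^sub>3\<bar>\<close> is bounded by both \<open>E0\<close> and \<open>24 - E0\<close>, is Lipschitz up to the threshold \<open>t = 0\<close>. Its threshold value is
  \<open>a(0)\<close> at both ends, as seen by translating the torus by \<open>(\<pi>, \<pi>, \<pi>)\<close>. Hence there is at most one zero on each
  side, and it exists precisely beyond the coupling threshold \<open>1 / a(0)\<close>.
\<close>

section \<open>Integration over the torus\<close>

lemma sets_cube: "cbox (\<chi> i. - pi) (\<chi> i. pi) \<inter> space lborel \<in> sets (lborel :: (real^3) measure)"
  by simp

interpretation T3: finite_measure T3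
proof
  have "emeasure T3 (space T3) = emeasure lborel (cbox (\<chi> i. - pi) (\<chi> i. pi) :: (real^3) set)"
    unfolding T3_def by (subst emeasure_restrict_space) (auto simp: space_restrict_space)
  also have "\<dots> < \<infinity>" by (rule emeasure_lborel_cbox_finite)
  finally show "emeasure T3 (space T3) \<noteq> \<infinity>" by simp
qed

lemma measurable_T3: "f \<in> borel_measurable borel \<Longrightarrow> f \<in> borel_measurable T3"
  unfolding T3_def by (rule measurable_restrict_space1) simp

lemma integrable_T3_bounded:
  fixes f :: "real^3 \<Rightarrow> 'b::{banach, second_countable_topology}"
  assumes "f \<in> borel_measurable borel" "\<And>p. norm (f p) \<le> B"
  shows "integrable T3 f"
  by (rule T3.integrable_const_bound[of _ B]) (use assms measurable_T3 in auto)

lemma AE_T3_iff: "(AE p in T3. P p) \<longleftrightarrow> (AE p in lborel. p \<in> cbox (\<chi> i. - pi) (\<chi> i. pi) \<longrightarrow> P p)"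
  unfolding T3_def by (rule AE_restrict_space_iff[OF sets_cube])

text \<open>If the integral were zero, the integrand would vanish almost everywhere on the cube and
  \<open>U\<close> would be Lebesgue negligible, which a nonempty open set never is.\<close>

lemma integral_T3_pos:
  fixes f :: "real^3 \<Rightarrow> real"
  assumes f: "integrable T3 f" "\<And>p. f p \<ge> 0"
    and U: "open U" "U \<noteq> {}" "U \<subseteq> cbox (\<chi> i. - pi) (\<chi> i. pi)" "\<And>p. p \<in> U \<Longrightarrow> f p > 0"
  shows "(LINT p|T3. f p) > 0"
proof (rule ccontr)
  assume "\<not> ?thesis"
  moreover have "(LINT p|T3. f p) \<ge> 0" using f(2) by simp
  ultimately have "(LINT p|T3. f p) = 0" by linarith
  hence "AE p in T3. f p = 0"
    using f by (subst (asm) integral_nonneg_eq_0_iff_AE) auto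
  hence "AE p in lborel. p \<notin> U"
    unfolding AE_T3_iff by eventually_elim (use U(3,4) in force)
  hence "U \<in> null_sets lborel"
    using U(1) by (subst AE_iff_null_sets) auto
  hence "U \<in> null_sets lebesgue"
    by (rule null_sets_completionI)
  hence "negligible U"
    by (simp add: negligible_iff_null_sets)
  thus False using open_not_negligible U(1,2) by blast
qed

text \<open>Cauchy-Schwarz against the constant 1, in variance form: after subtracting from
  \<open>h\<close> its mean \<open>t\<close>, the square still has nonnegative integral.\<close>

lemma integral_T3_power2_le:
  fixes h :: "real^3 \<Rightarrow> real"
  assumes "integrable T3 h" "integrable T3 (\<lambda>p. (h p)\<^sup>2)"
  shows "(LINT p|T3. h p)\<^sup>2 \<le> measure T3 (space T3) * (LINT p|T3. (h p)\<^sup>2)"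
proof -
  define m where "m = measure T3 (space T3)"
  have "(LINT p|T3. (1::real)) > 0"
  proof (rule integral_T3_pos[where U = "box (\<chi> i. - pi) (\<chi> i. pi)"])
    have "(0::real^3) \<in> box (\<chi> i. - pi) (\<chi> i. pi)" by (auto simp: mem_box_cart)
    thus "box (\<chi> i. - pi) (\<chi> i. pi) \<noteq> ({} :: (real^3) set)" by blast
  qed (auto simp: box_subset_cbox)
  hence m: "m > 0" by (simp add: m_def)
  define t where "t = (LINT p|T3. h p) / m"
  have "0 \<le> (LINT p|T3. (h p - t)\<^sup>2)" by simp
  also have "(\<lambda>p. (h p - t)\<^sup>2) = (\<lambda>p. (h p)\<^sup>2 - 2 * t * h p + t\<^sup>2)"
    by (auto simp: power2_eq_square algebra_simps)
  also have "(LINT p|T3. (h p)\<^sup>2 - 2 * t * h p + t\<^sup>2) = (LINT p|T3. (h p)\<^sup>2) - 2 * t * (LINT p|T3. h p) + m * t\<^sup>2"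
    using assms by (simp add: m_def)
  also have "\<dots> = (LINT p|T3. (h p)\<^sup>2) - (LINT p|T3. h p)\<^sup>2 / m"
    using m by (simp add: t_def power2_eq_square field_simps)
  finally show ?thesis using m by (simp add: m_def[symmetric] field_simps)
qed

section \<open>Fundamental domains and translations of the torus\<close>

lemma AE_cube_boundary:
  "AE p in lborel. p \<in> cbox (\<chi> i. - pi) (\<chi> i. pi) \<longrightarrow> p \<in> (box (\<chi> i. - pi) (\<chi> i. pi) :: (real^3) set)"
proof -
  let ?a = "(\<chi> i. - pi) :: real^3" and ?b = "(\<chi> i. pi) :: real^3"
  \<comment> \<open>The closed and the open cube have the same finite volume, so the faces form a
    null set.\<close>
  have "emeasure lborel (cbox ?a ?b - box ?a ?b) = emeasure lborel (cbox ?a ?b) - emeasure lborel (box ?a ?b)"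
    using emeasure_lborel_box_finite[of ?a ?b] by (intro emeasure_Diff) (auto simp: box_subset_cbox)
  also have "\<dots> = 0"
    by (simp add: emeasure_lborel_cbox_eq emeasure_lborel_box_eq)
  finally have "cbox ?a ?b - box ?a ?b \<in> null_sets lborel" by (intro null_setsI) auto
  hence "AE p in lborel. p \<notin> cbox ?a ?b - box ?a ?b" by (rule AE_not_in)
  thus ?thesis by eventually_elim auto
qed

text \<open>Half-open, so that it contains exactly one representative of each point of the torus and
  translations can be followed piece by piece without exceptional faces.\<close>

definition half_cube :: "(real^3) set" where
  "half_cube = {p. \<forall>i. - pi \<le> p$i \<and> p$i < pi}"

lemma sets_half_cube [measurable]: "half_cube \<in> sets borel"
  unfolding half_cube_def by measurable

lemma half_cube_bounds:
  "box (\<chi> i. - pi) (\<chi> i. pi) \<subseteq> half_cube" "half_cube \<subseteq> cbox (\<chi> i. - pi) (\<chi> i. pi)"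
  by (auto simp: half_cube_def mem_box_cart) (meson less_imp_le)+

lemma integral_T3_half_cube:
  fixes f :: "real^3 \<Rightarrow> real"
  assumes [measurable]: "f \<in> borel_measurable borel"
  shows "(LINT p|T3. f p) = (LINT p|lborel. indicator half_cube p * f p)"
proof -
  have "(LINT p|T3. f p) = (LINT p|lborel. indicator (cbox (\<chi> i. - pi) (\<chi> i. pi)) p * f p)"
    unfolding T3_def by (subst integral_restrict_space) auto
  also have "\<dots> = (LINT p|lborel. indicator half_cube p * f p)"
  proof (rule integral_cong_AE)
    show "AE p in lborel. indicator (cbox (\<chi> i. - pi) (\<chi> i. pi)) p * f p = indicator half_cube p * f p"
      using AE_cube_boundary
    proof eventually_elim
      case (elim p)
      have "p \<in> half_cube \<longleftrightarrow> p \<in> cbox (\<chi> i. - pi) (\<chi> i. pi)"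
        using elim half_cube_bounds by blast
      thus ?case by (simp add: indicator_def)
    qed
  qed auto
  finally show ?thesis .
qed

lemma integrable_lborel_bounded:
  fixes f :: "real^3 \<Rightarrow> real"
  assumes [measurable]: "f \<in> borel_measurable borel" and "\<And>p. \<bar>f p\<bar> \<le> B"
    and [measurable]: "A \<in> sets borel" and "A \<subseteq> half_cube"
  shows "integrable lborel (\<lambda>p. indicator A p * f p)"
proof (rule integrableI_bounded_set[where A = A and B = B])
  have "A \<subseteq> cbox (\<chi> i. - pi) (\<chi> i. pi)"
    using assms(4) half_cube_bounds(2) by blast
  hence "emeasure lborel A \<le> emeasure lborel (cbox (\<chi> i. - pi) (\<chi> i. pi) :: (real^3) set)"
    by (intro emeasure_mono) auto
  also have "\<dots> < \<infinity>" by (rule emeasure_lborel_cbox_finite)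
  finally show "emeasure lborel A < \<infinity>" .
  show "AE x in lborel. x \<in> A \<longrightarrow> norm (indicator A x * f x) \<le> B"
    using assms(2) by (auto simp: indicator_def)
qed (auto simp: indicator_def)

lemma integral_lborel_shift:
  fixes g :: "real^3 \<Rightarrow> real"
  assumes "g \<in> borel_measurable borel"
  shows "(LINT p|lborel. g (c + p)) = (LINT p|lborel. g p)"
proof -
  have "(LINT p|lborel. g p) = (LINT p|distr lborel borel ((+) c). g p)"
    by (simp add: lborel_distr_plus)
  also have "\<dots> = (LINT p|lborel. g (c + p))"
    using assms by (intro integral_distr) auto
  finally show ?thesis by simp
qed

text \<open>Translation by half a period exchanges the two halves of the fundamental domain.\<close>

lemma integral_T3_shift_axis:
  fixes f :: "real^3 \<Rightarrow> real"
  assumes f [measurable]: "f \<in> borel_measurable borel" and B: "\<And>p. \<bar>f p\<bar> \<le> B"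
    and per: "\<And>p i. f (p + axis i (2 * pi)) = f p"
  shows "(LINT p|T3. f (axis i pi + p)) = (LINT p|T3. f p)"
proof -
  define L where "L = {p \<in> half_cube. p$i < 0}"
  define R where "R = {p \<in> half_cube. p$i \<ge> 0}"
  have [measurable]: "L \<in> sets borel" "R \<in> sets borel"
    unfolding L_def R_def by measurable
  have shift_meas [measurable]: "(\<lambda>p. f (axis i pi + p)) \<in> borel_measurable borel" by measurable
  have split: "(LINT p|T3. g p) = (LINT p|lborel. indicator L p * g p) + (LINT p|lborel. indicator R p * g p)"
    if [measurable]: "g \<in> borel_measurable borel" and "\<And>p. \<bar>g p\<bar> \<le> B" for g :: "real^3 \<Rightarrow> real"
  proof -
    have eq: "(\<lambda>p. indicator half_cube p * g p) = (\<lambda>p. indicator L p * g p + indicator R p * g p)"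
      by (auto simp: indicator_def L_def R_def)
    have int: "integrable lborel (\<lambda>p. indicator L p * g p)" "integrable lborel (\<lambda>p. indicator R p * g p)"
      using that by (auto intro!: integrable_lborel_bounded[where B = B] simp: L_def R_def)
    show ?thesis
      by (simp only: integral_T3_half_cube[OF that(1)] eq Bochner_Integration.integral_add[OF int])
  qed
  have LR: "axis i pi + p \<in> R \<longleftrightarrow> p \<in> L" for p
  proof -
    have c: "(axis i pi + p)$j = (if j = i then pi + p$j else p$j)" for j
      by (simp add: axis_def)
    \<comment> \<open>For \<open>j\<close> other than \<open>i\<close> the two sides speak
      differently about the range of \<open>p$i\<close>, hence the guard. The instance
      \<open>j = i\<close> supplies the guard from either side of the equivalence.\<close>
    have "(- pi \<le> (axis i pi + p)$j \<and> (axis i pi + p)$j < pi \<and> 0 \<le> (axis i pi + p)$i) \<longleftrightarrow>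
        (- pi \<le> p$j \<and> p$j < pi \<and> p$i < 0)"
      if "j = i \<or> - pi \<le> p$i \<and> p$i < 0" for j
      using that pi_gt_zero unfolding c by auto
    from this[of i] this show ?thesis
      unfolding L_def R_def half_cube_def by blast
  qed
  have "(LINT p|lborel. indicator L p * f (axis i pi + p)) = (LINT p|lborel. indicator R (axis i pi + p) * f (axis i pi + p))"
    by (simp add: indicator_def LR)
  also have "\<dots> = (LINT p|lborel. indicator R p * f p)"
    by (subst integral_lborel_shift[where g = "\<lambda>p. indicator R p * f p"]) auto
  finally have 1: "(LINT p|lborel. indicator L p * f (axis i pi + p)) = (LINT p|lborel. indicator R p * f p)" .
  have per': "f (axis i pi + (axis i pi + p)) = f p" for p
  proof -
    have "axis i pi + (axis i pi + p) = p + axis i (2 * pi)"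
      by (auto simp: vec_eq_iff axis_def)
    thus ?thesis by (metis per)
  qed
  have "(LINT p|lborel. indicator L p * f p) = (LINT p|lborel. indicator R (axis i pi + p) * f (axis i pi + (axis i pi + p)))"
    unfolding per' by (simp add: indicator_def LR)
  also have "\<dots> = (LINT p|lborel. indicator R p * f (axis i pi + p))"
    by (subst integral_lborel_shift[where g = "\<lambda>p. indicator R p * f (axis i pi + p)"]) auto
  finally have 2: "(LINT p|lborel. indicator L p * f p) = (LINT p|lborel. indicator R p * f (axis i pi + p))" .
  show ?thesis
    using 1 2 B by (simp add: split)
qed

section \<open>The dispersion relation and the perturbation\<close>

lemma E0_eq: "E0 p = 12 - 4 * cos (p$1) - 4 * cos (p$2) - 4 * cos (p$3)"
  by (simp add: E0_def sum_3)

lemma E0_bounds: "0 \<le> E0 p" "E0 p \<le> 24"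
proof -
  have c: "cos (p$i) \<le> 1" "-1 \<le> cos (p$i)" for i by auto
  show "0 \<le> E0 p" "E0 p \<le> 24"
    unfolding E0_eq using c(1)[of 1] c(1)[of 2] c(1)[of 3] c(2)[of 1] c(2)[of 2] c(2)[of 3] by - (linarith+)
qed

lemma continuous_on_E0: "continuous_on UNIV E0"
  unfolding E0_eq[abs_def] by (intro continuous_intros)

lemma measurable_E0 [measurable]: "E0 \<in> borel_measurable borel"
  by (rule borel_measurable_continuous_onI[OF continuous_on_E0])

lemma E0_sym: "E0 (- p) = E0 p" "E0 (vector [p$2, p$1, p$3]) = E0 p"
   "E0 (vector [p$3, p$2, p$1]) = E0 p" "E0 (vector [p$1, p$3, p$2]) = E0 p"
  by (simp_all add: E0_eq)

lemma cos_periodic_axis: "cos ((p + axis i (2 * pi))$j) = cos (p$j)"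
  by (simp add: axis_def)

lemma E0_periodic: "E0 (p + axis i (2 * pi)) = E0 p"
  unfolding E0_eq cos_periodic_axis ..

lemma continuous_on_alpha3: "continuous_on UNIV (alpha3 \<theta>)"
  by (cases \<theta>) (simp_all add: alpha3.simps[abs_def], intro continuous_intros; simp)+

lemma measurable_alpha3 [measurable]: "alpha3 \<theta> \<in> borel_measurable borel"
  by (rule borel_measurable_continuous_onI[OF continuous_on_alpha3])

lemma alpha3_periodic: "alpha3 \<theta> (p + axis i (2 * pi)) = alpha3 \<theta> p"
  by (cases \<theta>) (simp_all only: alpha3.simps cos_periodic_axis)

lemma abs_divide_le_of_ge_1:
  fixes x y s :: real
  assumes "\<bar>x\<bar> \<le> y" "1 \<le> s"
  shows "\<bar>x / s\<bar> \<le> y"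
proof -
  have "\<bar>x\<bar> / s \<le> \<bar>x\<bar> / 1" using assms(2) by (intro frac_le) auto
  thus ?thesis using assms by (simp add: abs_divide)
qed

text \<open>\<open>E0\<close> is 4 times the sum of the terms 1 - cos, and \<open>24 - E0\<close> is
  4 times the sum of the terms 1 + cos. The numerators of \<open>alpha3\<close> are differences of
  such nonnegative terms with coefficients at most 2, and the denominators are at least 1. These
  bounds tame the singularities of the integrands at both thresholds.\<close>

lemma alpha3_le: "\<bar>alpha3 \<theta> p\<bar> \<le> E0 p" "\<bar>alpha3 \<theta> p\<bar> \<le> 24 - E0 p"
proof -
  obtain x y z where xyz: "cos (p$1) = x" "cos (p$2) = y" "cos (p$3) = z" by blast
  have b: "x \<le> 1" "-1 \<le> x" "y \<le> 1" "-1 \<le> y" "z \<le> 1" "-1 \<le> z"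
    unfolding xyz[symmetric] by auto
  have "1 \<le> pi ^ 3" using pi_gt3 by (intro one_le_power) simp
  hence s: "1 \<le> sqrt (8 * pi ^ 3)" "1 \<le> sqrt (24 * pi ^ 3)" by simp_all
  have E: "E0 p = 12 - 4 * x - 4 * y - 4 * z" by (simp add: E0_eq xyz)
  have "\<bar>alpha3 \<theta> p\<bar> \<le> E0 p \<and> \<bar>alpha3 \<theta> p\<bar> \<le> 24 - E0 p"
  proof (cases \<theta>)
    case A12
    have "\<bar>x - y\<bar> \<le> E0 p" "\<bar>x - y\<bar> \<le> 24 - E0 p"
      using b unfolding E by - (rule abs_leI; linarith)+
    thus ?thesis using s(1) by (simp only: A12 alpha3.simps xyz abs_divide_le_of_ge_1)
  next
    case Mix
    have "\<bar>x + y - 2 * z\<bar> \<le> E0 p" "\<bar>x + y - 2 * z\<bar> \<le> 24 - E0 p"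
      using b unfolding E by - (rule abs_leI; linarith)+
    thus ?thesis using s(2) by (simp only: Mix alpha3.simps xyz abs_divide_le_of_ge_1)
  qed
  thus "\<bar>alpha3 \<theta> p\<bar> \<le> E0 p" "\<bar>alpha3 \<theta> p\<bar> \<le> 24 - E0 p" by auto
qed

lemma alpha3_bound: "\<bar>alpha3 \<theta> p\<bar> \<le> 24"
  using alpha3_le(1)[of \<theta> p] E0_bounds(2)[of p] by linarith

lemma alpha3_sq_bound: "(alpha3 \<theta> p)\<^sup>2 \<le> 576"
  using power_mono[OF alpha3_bound[of \<theta> p], of 2] by simp

text \<open>By continuity it suffices to find one interior point of the layer at which
  \<open>alpha3\<close> does not vanish.\<close>

lemma level_set_integral_pos:
  assumes "0 \<le> a" "a < b" "b \<le> 24"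
  shows "(LINT p|T3. indicator {a<..<b} (E0 p) * (alpha3 \<theta> p)\<^sup>2) > 0"
proof (rule integral_T3_pos)
  define U where "U = box (\<chi> i. - pi) (\<chi> i. pi) \<inter> E0 -` {a<..<b} \<inter> alpha3 \<theta> -` (- {0})"
  show "integrable T3 (\<lambda>p. indicator {a<..<b} (E0 p) * (alpha3 \<theta> p)\<^sup>2)"
    by (rule integrable_T3_bounded[where B = 576]) (auto simp: indicator_def alpha3_sq_bound)
  show "0 \<le> indicator {a<..<b} (E0 p) * (alpha3 \<theta> p)\<^sup>2" for p by (simp add: indicator_def)
  show "open U" unfolding U_def
    using continuous_on_open_vimage[of UNIV E0] continuous_on_open_vimage[of UNIV "alpha3 \<theta>"]
      continuous_on_E0 continuous_on_alpha3
    by (intro open_Int open_box) (auto simp: open_Compl)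
  show "U \<subseteq> cbox (\<chi> i. - pi) (\<chi> i. pi)"
    unfolding U_def using box_subset_cbox by blast
  show "0 < indicator {a<..<b} (E0 p) * (alpha3 \<theta> p)\<^sup>2" if "p \<in> U" for p
    using that by (auto simp: U_def)
  \<comment> \<open>Cosines \<open>s + \<delta>\<close>, \<open>s\<close>,
    \<open>s - \<delta>\<close> add up to \<open>3 * s\<close>, which puts \<open>E0\<close> at the
    midpoint of \<open>a\<close> and \<open>b\<close>. The spread \<open>\<delta>\<close> gives the
    two numerators of \<open>alpha3\<close> the nonzero values \<open>\<delta>\<close> and
    \<open>3 * \<delta>\<close>, and is small enough to keep all three cosines strictly between -1
    and 1.\<close>
  define s where "s = 1 - (a + b) / 24"
  define \<delta> where "\<delta> = (1 - \<bar>s\<bar>) / 2"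
  have "s < 1" "- s < 1" using assms by (simp_all add: s_def field_simps)
  hence s: "\<bar>s\<bar> < 1" by (simp add: abs_less_iff)
  hence \<delta>: "\<delta> > 0" "\<bar>s\<bar> + \<delta> < 1" by (simp_all add: \<delta>_def field_simps)
  define p :: "real^3" where "p = vector [arccos (s + \<delta>), arccos s, arccos (s - \<delta>)]"
  have "- pi < arccos x \<and> arccos x < pi" if "\<bar>x\<bar> < 1" for x
    using that arccos_lt_bounded[of x] pi_gt_zero by (simp add: abs_less_iff)
  moreover have b: "\<bar>s + \<delta>\<bar> < 1" "\<bar>s - \<delta>\<bar> < 1" using s \<delta> by linarith+
  ultimately have "p \<in> box (\<chi> i. - pi) (\<chi> i. pi)"
    using s by (simp add: mem_box_cart p_def forall_3)
  moreover have c: "cos (p$1) = s + \<delta>" "cos (p$2) = s" "cos (p$3) = s - \<delta>"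
    using s b by (auto simp: p_def intro!: cos_arccos)
  hence "E0 p = (a + b) / 2" by (simp add: E0_eq s_def)
  moreover have "alpha3 \<theta> p \<noteq> 0"
    using c \<delta> by (cases \<theta>) auto
  ultimately have "p \<in> U" using assms by (auto simp: U_def)
  thus "U \<noteq> {}" by blast
qed

lemma alpha3_integrable: "integrable T3 (\<lambda>p. (alpha3 \<theta> p)\<^sup>2)"
  by (rule integrable_T3_bounded[where B = 576]) (auto simp: alpha3_sq_bound)

lemma alpha3_norm_pos: "(LINT p|T3. (alpha3 \<theta> p)\<^sup>2) > 0"
proof -
  have "0 < (LINT p|T3. indicator {0<..<24} (E0 p) * (alpha3 \<theta> p)\<^sup>2)"
    by (rule level_set_integral_pos) auto
  also have "\<dots> \<le> (LINT p|T3. (alpha3 \<theta> p)\<^sup>2)"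
    by (intro integral_mono alpha3_integrable integrable_T3_bounded[where B = 576])
      (auto simp: indicator_def alpha3_sq_bound)
  finally show ?thesis .
qed

text \<open>The translation by \<open>(\<pi>, \<pi>, \<pi>)\<close> maps \<open>E0\<close> to \<open>24 - E0\<close> and \<open>\<alpha>\<^sub>3\<close> to \<open>- \<alpha>\<^sub>3\<close>.\<close>

lemma a0_reflect: "(LINT p|T3. (alpha3 \<theta> p)\<^sup>2 / (24 - E0 p)) = a0 \<theta>"
proof -
  define f where "f = (\<lambda>p. (alpha3 \<theta> p)\<^sup>2 / (24 - E0 p))"
  have f [measurable]: "f \<in> borel_measurable borel" unfolding f_def by measurable
  have B: "\<bar>f p\<bar> \<le> 24" for p
  \<comment> \<open>Where \<open>E0 p = 24\<close> the quotient is 0 by the convention for division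
    by zero.\<close>
  proof (cases "24 - E0 p = 0")
    case False
    hence "24 - E0 p > 0" using E0_bounds(2)[of p] by linarith
    moreover have "(alpha3 \<theta> p)\<^sup>2 \<le> 24 * (24 - E0 p)"
      using mult_mono[OF alpha3_bound alpha3_le(2), of \<theta> p \<theta> p] by (simp add: power2_eq_square abs_mult[symmetric])
    ultimately show ?thesis by (simp add: f_def field_simps)
  qed (simp add: f_def)
  have per: "f (p + axis i (2 * pi)) = f p" for p i
    by (simp add: f_def alpha3_periodic E0_periodic)
  have per': "f (axis j pi + (p + axis i (2 * pi))) = f (axis j pi + p)"
    "f (axis j pi + (axis k pi + (p + axis i (2 * pi)))) = f (axis j pi + (axis k pi + p))" for p i j k
    by (simp_all add: per add.assoc[symmetric])
  have "(LINT p|T3. f p) = (LINT p|T3. f (axis 1 pi + p))"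
    by (intro integral_T3_shift_axis[symmetric, where B = 24] f B per)
  also have "\<dots> = (LINT p|T3. f (axis 1 pi + (axis 2 pi + p)))"
    by (intro integral_T3_shift_axis[symmetric, where B = 24 and f = "\<lambda>p. f (axis 1 pi + p)"] B per') measurable
  also have "\<dots> = (LINT p|T3. f (axis 1 pi + (axis 2 pi + (axis 3 pi + p))))"
    by (intro integral_T3_shift_axis[symmetric, where B = 24 and f = "\<lambda>p. f (axis 1 pi + (axis 2 pi + p))"] B per') measurable
  also have "(\<lambda>p. f (axis 1 pi + (axis 2 pi + (axis 3 pi + p)))) = (\<lambda>p. (alpha3 \<theta> p)\<^sup>2 / E0 p)"
  proof
    fix p :: "real^3"
    define q where "q = axis 1 pi + (axis 2 pi + (axis 3 pi + p))"
    have "q$i = p$i + pi" for i using exhaust_3[of i] by (auto simp: q_def axis_def)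
    hence c: "cos (q$i) = - cos (p$i)" for i by simp
    have "24 - E0 q = E0 p" by (simp add: E0_eq c)
    moreover have "alpha3 \<theta> q = - alpha3 \<theta> p"
      by (cases \<theta>) (simp_all add: c field_simps)
    ultimately show "f q = (alpha3 \<theta> p)\<^sup>2 / E0 p" by (simp add: f_def)
  qed
  finally show ?thesis by (simp add: f_def a0_def)
qed

section \<open>The function spaces\<close>

lemma L2_measurable: "f \<in> L2 \<Longrightarrow> f \<in> borel_measurable borel"
  by (simp add: L2_def)

lemma L2_square_integrable: "f \<in> L2 \<Longrightarrow> integrable T3 (\<lambda>p. (cmod (f p))\<^sup>2)"
  by (simp add: L2_def)

lemma L2_periodic: "f \<in> L2 \<Longrightarrow> f (p + axis i (2 * pi)) = f p"
  by (simp add: L2_def)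

text \<open>A crude substitute for the triangle inequality in \<open>L2\<close>: the factor 2 is
  harmless, since boundedness of an inverse asks only for some constant.\<close>

lemma cmod_lincomb_sq: "(cmod (a * x + b * y))\<^sup>2 \<le> 2 * (cmod a)\<^sup>2 * (cmod x)\<^sup>2 + 2 * (cmod b)\<^sup>2 * (cmod y)\<^sup>2"
proof -
  have "(cmod (a * x + b * y))\<^sup>2 \<le> (cmod (a * x) + cmod (b * y))\<^sup>2"
    by (intro power_mono norm_triangle_ineq) simp
  also have "\<dots> \<le> 2 * (cmod (a * x))\<^sup>2 + 2 * (cmod (b * y))\<^sup>2"
    using zero_le_power2[of "cmod (a * x) - cmod (b * y)"] by (simp only: power2_diff power2_sum)
  finally show ?thesis by (simp add: norm_mult power_mult_distrib)
qed

lemma L2_lincomb: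
  assumes f: "f \<in> L2" and g: "g \<in> L2"
  shows "(\<lambda>p. a * f p + b * g p) \<in> L2"
    and "(LINT p|T3. (cmod (a * f p + b * g p))\<^sup>2) \<le>
      2 * (cmod a)\<^sup>2 * (LINT p|T3. (cmod (f p))\<^sup>2) + 2 * (cmod b)\<^sup>2 * (LINT p|T3. (cmod (g p))\<^sup>2)"
proof -
  note [measurable] = L2_measurable[OF f] L2_measurable[OF g]
  let ?h = "\<lambda>p. 2 * (cmod a)\<^sup>2 * (cmod (f p))\<^sup>2 + 2 * (cmod b)\<^sup>2 * (cmod (g p))\<^sup>2"
  have h: "integrable T3 ?h"
    using L2_square_integrable[OF f] L2_square_integrable[OF g] by simp
  have i: "integrable T3 (\<lambda>p. (cmod (a * f p + b * g p))\<^sup>2)"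
    by (rule Bochner_Integration.integrable_bound[OF h])
      (auto intro!: measurable_T3 order_trans[OF cmod_lincomb_sq] AE_I2)
  show "(\<lambda>p. a * f p + b * g p) \<in> L2"
    using i L2_periodic[OF f] L2_periodic[OF g] by (simp add: L2_def)
  have "(LINT p|T3. (cmod (a * f p + b * g p))\<^sup>2) \<le> (LINT p|T3. ?h p)"
    by (rule integral_mono[OF i h]) (rule cmod_lincomb_sq)
  also have "\<dots> = 2 * (cmod a)\<^sup>2 * (LINT p|T3. (cmod (f p))\<^sup>2) + 2 * (cmod b)\<^sup>2 * (LINT p|T3. (cmod (g p))\<^sup>2)"
    using L2_square_integrable[OF f] L2_square_integrable[OF g] by simp
  finally show "(LINT p|T3. (cmod (a * f p + b * g p))\<^sup>2) \<le>
      2 * (cmod a)\<^sup>2 * (LINT p|T3. (cmod (f p))\<^sup>2) + 2 * (cmod b)\<^sup>2 * (LINT p|T3. (cmod (g p))\<^sup>2)" .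
qed

lemma L2_mult:
  assumes f: "f \<in> L2" and \<psi> [measurable]: "\<psi> \<in> borel_measurable borel"
    and B: "\<And>p. cmod (\<psi> p) \<le> B" and per: "\<And>p i. \<psi> (p + axis i (2 * pi)) = \<psi> p"
  shows "(\<lambda>p. \<psi> p * f p) \<in> L2"
    and "(LINT p|T3. (cmod (\<psi> p * f p))\<^sup>2) \<le> B\<^sup>2 * (LINT p|T3. (cmod (f p))\<^sup>2)"
proof -
  note [measurable] = L2_measurable[OF f]
  have le: "(cmod (\<psi> p * f p))\<^sup>2 \<le> B\<^sup>2 * (cmod (f p))\<^sup>2" for p
    unfolding norm_mult power_mult_distrib by (intro mult_right_mono power_mono B) auto
  have h: "integrable T3 (\<lambda>p. B\<^sup>2 * (cmod (f p))\<^sup>2)"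
    using L2_square_integrable[OF f] by simp
  have i: "integrable T3 (\<lambda>p. (cmod (\<psi> p * f p))\<^sup>2)"
    by (rule Bochner_Integration.integrable_bound[OF h])
      (auto intro!: measurable_T3 order_trans[OF le] AE_I2)
  show "(\<lambda>p. \<psi> p * f p) \<in> L2"
    using i L2_periodic[OF f] per by (simp add: L2_def)
  have "(LINT p|T3. (cmod (\<psi> p * f p))\<^sup>2) \<le> (LINT p|T3. B\<^sup>2 * (cmod (f p))\<^sup>2)"
    by (rule integral_mono[OF i h le])
  thus "(LINT p|T3. (cmod (\<psi> p * f p))\<^sup>2) \<le> B\<^sup>2 * (LINT p|T3. (cmod (f p))\<^sup>2)" by simp
qed

lemma L2_bounded:
  assumes [measurable]: "f \<in> borel_measurable borel" and "\<And>p. cmod (f p) \<le> B"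
    and "\<And>p i. f (p + axis i (2 * pi)) = f p"
  shows "f \<in> L2"
proof -
  have "integrable T3 (\<lambda>p. (cmod (f p))\<^sup>2)"
    using assms(2) by (intro integrable_T3_bounded[where B = "B\<^sup>2"]) (auto intro!: power_mono)
  thus ?thesis using assms by (simp add: L2_def)
qed

lemma L2_integrable:
  assumes f: "f \<in> L2" shows "integrable T3 f"
proof -
  note m = measurable_T3[OF L2_measurable[OF f]]
  have mn: "(\<lambda>p. cmod (f p)) \<in> borel_measurable T3" using m by measurable
  have "integrable T3 (\<lambda>p. cmod (f p))"
    by (rule T3.square_integrable_imp_integrable[OF mn L2_square_integrable[OF f]])
  thus ?thesis using integrable_norm_iff[OF m] by simp
qed

lemma norm_L2_eq_0_iff:
  assumes "f \<in> L2" shows "norm_L2 f = 0 \<longleftrightarrow> f =\<^sub>a\<^sub>e (\<lambda>p. 0)"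
  using L2_square_integrable[OF assms]
  by (simp add: norm_L2_def ae_eq_def integral_nonneg_eq_0_iff_AE)

lemma L2_e_lincomb:
  assumes "f \<in> L2_e" "g \<in> L2_e" shows "(\<lambda>p. a * f p + b * g p) \<in> L2_e"
proof -
  have "AE p in T3. f (- p) = f p" "AE p in T3. g (- p) = g p"
    using assms by (auto simp: L2_e_def ae_eq_def)
  hence "AE p in T3. a * f (- p) + b * g (- p) = a * f p + b * g p"
    by eventually_elim simp
  thus ?thesis using assms L2_lincomb(1) by (simp add: L2_e_def ae_eq_def)
qed

lemma L2_sym_L2: "f \<in> L2_sym \<theta> \<Longrightarrow> f \<in> L2"
  by (cases \<theta>) (auto simp: L2_e_a12_def L2_e_mix_def L2_e_def)

lemma L2_sym_lincomb:
  assumes "f \<in> L2_sym \<theta>" "g \<in> L2_sym \<theta>"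
  shows "(\<lambda>p. a * f p + b * g p) \<in> L2_sym \<theta>"
proof (cases \<theta>)
  case A12
  have "AE p in T3. f p = - f (vector [p$2, p$1, p$3])" "AE p in T3. g p = - g (vector [p$2, p$1, p$3])"
    using assms by (auto simp: A12 L2_e_a12_def ae_eq_def)
  hence "AE p in T3. a * f p + b * g p = - (a * f (vector [p$2, p$1, p$3]) + b * g (vector [p$2, p$1, p$3]))"
    by eventually_elim simp
  thus ?thesis using assms L2_e_lincomb by (simp add: A12 L2_e_a12_def ae_eq_def)
next
  case Mix
  obtain f1 f2 where f: "f \<in> L2_e" "AE p in T3. f p = f (vector [p$2, p$1, p$3])" "f1 \<in> L2_e" "f2 \<in> L2_e"
    "AE p in T3. f p = f1 p + f2 p" "AE p in T3. f1 p = - f1 (vector [p$3, p$2, p$1])"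
    "AE p in T3. f2 p = - f2 (vector [p$1, p$3, p$2])"
    using assms(1) by (auto simp: Mix L2_e_mix_def ae_eq_def)
  obtain g1 g2 where g: "g \<in> L2_e" "AE p in T3. g p = g (vector [p$2, p$1, p$3])" "g1 \<in> L2_e" "g2 \<in> L2_e"
    "AE p in T3. g p = g1 p + g2 p" "AE p in T3. g1 p = - g1 (vector [p$3, p$2, p$1])"
    "AE p in T3. g2 p = - g2 (vector [p$1, p$3, p$2])"
    using assms(2) by (auto simp: Mix L2_e_mix_def ae_eq_def)
  let ?h1 = "\<lambda>p. a * f1 p + b * g1 p" and ?h2 = "\<lambda>p. a * f2 p + b * g2 p"
  have "AE p in T3. a * f p + b * g p = a * f (vector [p$2, p$1, p$3]) + b * g (vector [p$2, p$1, p$3])"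
    using f(2) g(2) by eventually_elim simp
  moreover have "AE p in T3. a * f p + b * g p = ?h1 p + ?h2 p"
    using f(5) g(5) by eventually_elim (simp add: algebra_simps)
  moreover have "AE p in T3. ?h1 p = - ?h1 (vector [p$3, p$2, p$1])"
    using f(6) g(6) by eventually_elim simp
  moreover have "AE p in T3. ?h2 p = - ?h2 (vector [p$1, p$3, p$2])"
    using f(7) g(7) by eventually_elim simp
  moreover note L2_e_lincomb[OF f(1) g(1)] L2_e_lincomb[OF f(3) g(3)] L2_e_lincomb[OF f(4) g(4)]
  ultimately show ?thesis
    unfolding Mix L2_sym.simps L2_e_mix_def ae_eq_def
    by (intro CollectI conjI bexI[where x = ?h1] bexI[where x = ?h2]) assumption+
qed

lemma L2_E0_mult:
  fixes \<phi> :: "real \<Rightarrow> complex"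
  assumes "f \<in> L2" "\<phi> \<in> borel_measurable borel" "\<And>p. cmod (\<phi> (E0 p)) \<le> B"
  shows "(\<lambda>p. \<phi> (E0 p) * f p) \<in> L2"
    and "(LINT p|T3. (cmod (\<phi> (E0 p) * f p))\<^sup>2) \<le> B\<^sup>2 * (LINT p|T3. (cmod (f p))\<^sup>2)"
proof -
  have m: "(\<lambda>p. \<phi> (E0 p)) \<in> borel_measurable borel"
    using measurable_compose[OF measurable_E0 assms(2)] by simp
  note M = L2_mult[OF assms(1) m assms(3)]
  show "(\<lambda>p. \<phi> (E0 p) * f p) \<in> L2" by (rule M(1)) (simp add: E0_periodic)
  show "(LINT p|T3. (cmod (\<phi> (E0 p) * f p))\<^sup>2) \<le> B\<^sup>2 * (LINT p|T3. (cmod (f p))\<^sup>2)"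
    by (rule M(2)) (simp add: E0_periodic)
qed

text \<open>\<open>E0\<close> is even and invariant under permutations of the coordinates, so
  multiplication by a function of \<open>E0\<close> commutes with every reflection and swap in the
  definition of the spaces. In the mixed case both components of the decomposition are
  multiplied.\<close>

lemma L2_sym_E0_mult:
  fixes \<phi> :: "real \<Rightarrow> complex"
  assumes f: "f \<in> L2_sym \<theta>" and \<phi>: "\<phi> \<in> borel_measurable borel" "\<And>p. cmod (\<phi> (E0 p)) \<le> B"
  shows "(\<lambda>p. \<phi> (E0 p) * f p) \<in> L2_sym \<theta>"
proof -
  have e: "(\<lambda>p. \<phi> (E0 p) * g p) \<in> L2_e" if "g \<in> L2_e" for g
  proof -
    have "AE p in T3. g (- p) = g p" using that by (auto simp: L2_e_def ae_eq_def)
    hence "AE p in T3. \<phi> (E0 (- p)) * g (- p) = \<phi> (E0 p) * g p"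
      by eventually_elim (simp add: E0_sym)
    thus ?thesis using that L2_E0_mult(1)[OF _ \<phi>] by (simp add: L2_e_def ae_eq_def)
  qed
  show ?thesis
  proof (cases \<theta>)
    case A12
    have "AE p in T3. f p = - f (vector [p$2, p$1, p$3])"
      using f by (auto simp: A12 L2_e_a12_def ae_eq_def)
    hence "AE p in T3. \<phi> (E0 p) * f p = - (\<phi> (E0 (vector [p$2, p$1, p$3])) * f (vector [p$2, p$1, p$3]))"
      by eventually_elim (simp add: E0_sym)
    thus ?thesis using f e by (simp add: A12 L2_e_a12_def ae_eq_def)
  next
    case Mix
    obtain f1 f2 where f: "f \<in> L2_e" "AE p in T3. f p = f (vector [p$2, p$1, p$3])" "f1 \<in> L2_e" "f2 \<in> L2_e"
      "AE p in T3. f p = f1 p + f2 p" "AE p in T3. f1 p = - f1 (vector [p$3, p$2, p$1])"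
      "AE p in T3. f2 p = - f2 (vector [p$1, p$3, p$2])"
      using f by (auto simp: Mix L2_e_mix_def ae_eq_def)
    let ?h1 = "\<lambda>p. \<phi> (E0 p) * f1 p" and ?h2 = "\<lambda>p. \<phi> (E0 p) * f2 p"
    have "AE p in T3. \<phi> (E0 p) * f p = \<phi> (E0 (vector [p$2, p$1, p$3])) * f (vector [p$2, p$1, p$3])"
      using f(2) by eventually_elim (simp add: E0_sym)
    moreover have "AE p in T3. \<phi> (E0 p) * f p = ?h1 p + ?h2 p"
      using f(5) by eventually_elim (simp add: algebra_simps)
    moreover have "AE p in T3. ?h1 p = - ?h1 (vector [p$3, p$2, p$1])"
      using f(6) by eventually_elim (simp add: E0_sym)
    moreover have "AE p in T3. ?h2 p = - ?h2 (vector [p$1, p$3, p$2])"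
      using f(7) by eventually_elim (simp add: E0_sym)
    moreover note e[OF f(1)] e[OF f(3)] e[OF f(4)]
    ultimately show ?thesis
      unfolding Mix L2_sym.simps L2_e_mix_def ae_eq_def
      by (intro CollectI conjI bexI[where x = ?h1] bexI[where x = ?h2]) assumption+
  qed
qed

section \<open>Membership of \<open>alpha3\<close> in the symmetry spaces and pairing with
  it\<close>

abbreviation \<alpha>\<^sub>c :: "symmetry \<Rightarrow> real^3 \<Rightarrow> complex" where
  "\<alpha>\<^sub>c \<theta> \<equiv> \<lambda>p. complex_of_real (alpha3 \<theta> p)"

lemma alpha3_L2_sym: "\<alpha>\<^sub>c \<theta> \<in> L2_sym \<theta>"
proof -
  have L: "\<alpha>\<^sub>c \<theta> \<in> L2"
    by (rule L2_bounded[where B = 24]) (auto simp: alpha3_bound alpha3_periodic)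
  have ev: "alpha3 \<theta> (- p) = alpha3 \<theta> p" for p
    by (cases \<theta>) simp_all
  have e: "\<alpha>\<^sub>c \<theta> \<in> L2_e" using L ev by (simp add: L2_e_def ae_eq_def)
  show ?thesis
  proof (cases \<theta>)
    case A12
    have "\<alpha>\<^sub>c \<theta> p = - \<alpha>\<^sub>c \<theta> (vector [p$2, p$1, p$3])" for p
      by (simp add: A12 field_simps)
    thus ?thesis using e by (simp add: A12 L2_e_a12_def ae_eq_def)
  next
    case Mix
    \<comment> \<open>The mixed numerator splits as (cos p1 - cos p3) + (cos p2 - cos p3); the
      summands are antisymmetric under the swaps of 1, 3 and of 2, 3 respectively.\<close>
    define h where "h = (\<lambda>i p. complex_of_real ((cos (p$i) - cos (p$(3::3))) / sqrt (24 * pi ^ 3)))"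
    have h: "h i \<in> L2_e" for i
    proof -
      have b: "cmod (h i p) \<le> 2 / sqrt (24 * pi ^ 3)" for p
      proof -
        have "\<bar>cos (p$i) - cos (p$3)\<bar> \<le> 2"
          using abs_triangle_ineq4[of "cos (p$i)" "cos (p$3)"] abs_cos_le_one[of "p$i"] abs_cos_le_one[of "p$3"]
          by linarith
        thus ?thesis
          unfolding h_def norm_of_real abs_divide by (intro frac_le) auto
      qed
      have "h i (p + axis j (2 * pi)) = h i p" for p j
        unfolding h_def cos_periodic_axis ..
      moreover have "h i \<in> borel_measurable borel" unfolding h_def by measurable
      ultimately have "h i \<in> L2" using b L2_bounded by blast
      thus ?thesis by (simp add: L2_e_def ae_eq_def h_def)
    qed
    have "\<alpha>\<^sub>c \<theta> p = \<alpha>\<^sub>c \<theta> (vector [p$2, p$1, p$3])" "\<alpha>\<^sub>c \<theta> p = h 1 p + h 2 p"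
       "h 1 p = - h 1 (vector [p$3, p$2, p$1])" "h 2 p = - h 2 (vector [p$1, p$3, p$2])" for p
      by (simp_all add: Mix h_def add_divide_distrib diff_divide_distrib)
    hence "AE p in T3. \<alpha>\<^sub>c \<theta> p = \<alpha>\<^sub>c \<theta> (vector [p$2, p$1, p$3])" "AE p in T3. \<alpha>\<^sub>c \<theta> p = h 1 p + h 2 p"
       "AE p in T3. h 1 p = - h 1 (vector [p$3, p$2, p$1])" "AE p in T3. h 2 p = - h 2 (vector [p$1, p$3, p$2])"
      by blast+
    thus ?thesis
      using e h unfolding Mix L2_sym.simps L2_e_mix_def ae_eq_def by blast
  qed
qed

lemmas alpha3_L2 = L2_sym_L2[OF alpha3_L2_sym]

lemma L2_mult_alpha3:
  assumes "f \<in> L2"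
  shows "(\<lambda>p. f p * \<alpha>\<^sub>c \<theta> p) \<in> L2"
    and "(LINT p|T3. (cmod (f p * \<alpha>\<^sub>c \<theta> p))\<^sup>2) \<le> 24\<^sup>2 * (LINT p|T3. (cmod (f p))\<^sup>2)"
proof -
  have m: "\<alpha>\<^sub>c \<theta> \<in> borel_measurable borel" by measurable
  have b: "cmod (\<alpha>\<^sub>c \<theta> p) \<le> 24" for p by (simp add: alpha3_bound)
  have per: "\<alpha>\<^sub>c \<theta> (p + axis i (2 * pi)) = \<alpha>\<^sub>c \<theta> p" for p i by (simp only: alpha3_periodic)
  show "(\<lambda>p. f p * \<alpha>\<^sub>c \<theta> p) \<in> L2"
    and "(LINT p|T3. (cmod (f p * \<alpha>\<^sub>c \<theta> p))\<^sup>2) \<le> 24\<^sup>2 * (LINT p|T3. (cmod (f p))\<^sup>2)"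
    using L2_mult[OF assms m b per] by (simp_all only: mult.commute[of "\<alpha>\<^sub>c \<theta> _"])
qed

lemma inner_alpha3: "inner_L2 f (\<alpha>\<^sub>c \<theta>) = (LINT p|T3. f p * \<alpha>\<^sub>c \<theta> p)"
  by (simp add: inner_L2_def)

lemma inner_alpha3_lincomb:
  assumes "f \<in> L2" "g \<in> L2"
  shows "inner_L2 (\<lambda>p. a * f p + b * g p) (\<alpha>\<^sub>c \<theta>) = a * inner_L2 f (\<alpha>\<^sub>c \<theta>) + b * inner_L2 g (\<alpha>\<^sub>c \<theta>)"
  using L2_integrable[OF L2_mult_alpha3(1)[OF assms(1)]] L2_integrable[OF L2_mult_alpha3(1)[OF assms(2)]]
  by (simp add: inner_alpha3 distrib_right mult.assoc)

lemma inner_alpha3_cong: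
  assumes "f \<in> L2" "g \<in> L2" "f =\<^sub>a\<^sub>e g"
  shows "inner_L2 f (\<alpha>\<^sub>c \<theta>) = inner_L2 g (\<alpha>\<^sub>c \<theta>)"
  unfolding inner_alpha3
proof (rule integral_cong_AE)
  show "AE p in T3. f p * \<alpha>\<^sub>c \<theta> p = g p * \<alpha>\<^sub>c \<theta> p"
    using assms(3) unfolding ae_eq_def by eventually_elim simp
qed (use assms in \<open>auto intro!: measurable_T3 L2_measurable L2_mult_alpha3(1)\<close>)

text \<open>Continuity of the functional given by \<open>alpha3\<close>: the bounded factor is
  absorbed first, and Cauchy-Schwarz against the constant 1 does the rest.\<close>

lemma inner_alpha3_bound:
  "\<exists>K\<ge>0. \<forall>f\<in>L2. (cmod (inner_L2 f (\<alpha>\<^sub>c \<theta>)))\<^sup>2 \<le> K * (LINT p|T3. (cmod (f p))\<^sup>2)"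
proof (intro exI[of _ "measure T3 (space T3) * 24\<^sup>2"] conjI ballI)
  fix f assume f: "f \<in> L2"
  note fa = L2_mult_alpha3(1)[OF f, of \<theta>]
  have "(cmod (inner_L2 f (\<alpha>\<^sub>c \<theta>)))\<^sup>2 \<le> (LINT p|T3. cmod (f p * \<alpha>\<^sub>c \<theta> p))\<^sup>2"
    unfolding inner_alpha3 by (intro power_mono integral_norm_bound) simp
  also have "\<dots> \<le> measure T3 (space T3) * (LINT p|T3. (cmod (f p * \<alpha>\<^sub>c \<theta> p))\<^sup>2)"
    by (intro integral_T3_power2_le integrable_norm L2_integrable fa L2_square_integrable)
  also have "\<dots> \<le> measure T3 (space T3) * (24\<^sup>2 * (LINT p|T3. (cmod (f p))\<^sup>2))"
    by (intro mult_left_mono L2_mult_alpha3(2) f) simp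
  finally show "(cmod (inner_L2 f (\<alpha>\<^sub>c \<theta>)))\<^sup>2 \<le> measure T3 (space T3) * 24\<^sup>2 * (LINT p|T3. (cmod (f p))\<^sup>2)"
    by simp
qed simp

section \<open>Resolvent and eigenvalues\<close>

definition continuum :: "complex set" where
  "continuum = complex_of_real ` {0..24}"

text \<open>The interval is compact, hence at positive distance from \<open>z\<close>, and it
  contains all values of \<open>E0\<close>.\<close>

lemma continuum_dist:
  assumes "z \<notin> continuum"
  obtains d where "d > 0" "\<And>p. d \<le> cmod (of_real (E0 p) - z)"
proof -
  have "closed continuum"
    unfolding continuum_def by (intro compact_imp_closed compact_continuous_image continuous_intros) auto
  then obtain d where d: "d > 0" "\<forall>x\<in>continuum. d \<le> dist z x"
    using separate_point_closed assms by blast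
  have "d \<le> cmod (of_real (E0 p) - z)" for p
  proof -
    have "of_real (E0 p) \<in> continuum" unfolding continuum_def using E0_bounds[of p] by (intro imageI) simp
    thus ?thesis using d(2) by (metis dist_norm norm_minus_commute)
  qed
  thus ?thesis using that d(1) by blast
qed

lemma E0_neq:
  assumes "z \<notin> continuum" shows "of_real (E0 p) - z \<noteq> 0"
  using continuum_dist[OF assms] by (metis norm_zero not_le)

text \<open>Off the continuum the resolvent of \<open>H0\<close> is multiplication by a bounded
  function of \<open>E0\<close>, so it is bounded and preserves the symmetry spaces.\<close>

lemma free_resolvent:
  assumes z: "z \<notin> continuum"
  shows "f \<in> L2_sym \<theta> \<Longrightarrow> (\<lambda>p. f p / (of_real (E0 p) - z)) \<in> L2_sym \<theta>"
    and "\<exists>B\<ge>0. \<forall>f\<in>L2. (\<lambda>p. f p / (of_real (E0 p) - z)) \<in> L2 \<and>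
        (LINT p|T3. (cmod (f p / (of_real (E0 p) - z)))\<^sup>2) \<le> B * (LINT p|T3. (cmod (f p))\<^sup>2)"
proof -
  obtain d where d: "d > 0" "\<And>p. d \<le> cmod (of_real (E0 p) - z)"
    using continuum_dist[OF z] by blast
  have m: "(\<lambda>x. 1 / (complex_of_real x - z)) \<in> borel_measurable borel" by measurable
  have b: "cmod (1 / (complex_of_real (E0 p) - z)) \<le> 1 / d" for p
    unfolding norm_divide using d by (intro frac_le) auto
  show "(\<lambda>p. f p / (of_real (E0 p) - z)) \<in> L2_sym \<theta>" if "f \<in> L2_sym \<theta>"
    using L2_sym_E0_mult[OF that m b] by simp
  show "\<exists>B\<ge>0. \<forall>f\<in>L2. (\<lambda>p. f p / (of_real (E0 p) - z)) \<in> L2 \<and>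
        (LINT p|T3. (cmod (f p / (of_real (E0 p) - z)))\<^sup>2) \<le> B * (LINT p|T3. (cmod (f p))\<^sup>2)"
    using L2_E0_mult[OF _ m b] by (intro exI[of _ "(1 / d)\<^sup>2"]) auto
qed

text \<open>The Fredholm determinant of \<open>H\<close> is \<open>1 + \<mu> * resolvent_form \<theta> z\<close>.\<close>

definition resolvent_form :: "symmetry \<Rightarrow> complex \<Rightarrow> complex" where
  "resolvent_form \<theta> z = inner_L2 (\<lambda>p. \<alpha>\<^sub>c \<theta> p / (of_real (E0 p) - z)) (\<alpha>\<^sub>c \<theta>)"

lemma H_eq: "H \<theta> \<mu> f p = of_real (E0 p) * f p + of_real \<mu> * inner_L2 f (\<alpha>\<^sub>c \<theta>) * \<alpha>\<^sub>c \<theta> p"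
  by (simp add: H_def H0_def)

lemma H_shifted_L2:
  assumes "f \<in> L2" shows "(\<lambda>p. H \<theta> \<mu> f p - z * f p) \<in> L2"
proof -
  have "(\<lambda>p. of_real (E0 p) * f p) \<in> L2"
    using L2_E0_mult(1)[OF assms, of of_real 24] E0_bounds by simp
  from L2_lincomb(1)[OF L2_lincomb(1)[OF this alpha3_L2[of \<theta>], of 1 "of_real \<mu> * inner_L2 f (\<alpha>\<^sub>c \<theta>)"] assms, of 1 "- z"]
  show ?thesis by (simp add: H_eq)
qed

text \<open>With R the free resolvent and s the pairing of f with \<open>alpha3\<close>, the
  equation (H - z) f = g reads f = R g - \<mu> s R \<open>alpha3\<close>. Pairing this with
  \<open>alpha3\<close> gives s \<Delta> = (R g, \<open>alpha3\<close>), which determines s when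
  \<Delta> is nonzero. The same formula yields surjectivity and the norm estimate.\<close>

lemma regular_point_resolvent:
  assumes z: "z \<notin> continuum" and \<Delta>: "1 + of_real \<mu> * resolvent_form \<theta> z \<noteq> 0"
  shows "z \<in> resolvent_set (L2_sym \<theta>) (H \<theta> \<mu>)"
proof -
  define \<Delta> where "\<Delta> = 1 + of_real \<mu> * resolvent_form \<theta> z"
  note ne = E0_neq[OF z]
  define r where "r = (\<lambda>p. \<alpha>\<^sub>c \<theta> p / (of_real (E0 p) - z))"
  have r: "r \<in> L2_sym \<theta>" unfolding r_def by (rule free_resolvent(1)[OF z alpha3_L2_sym])
  obtain B where B: "B \<ge> 0" "\<And>f. f \<in> L2 \<Longrightarrow> (\<lambda>p. f p / (of_real (E0 p) - z)) \<in> L2"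
    "\<And>f. f \<in> L2 \<Longrightarrow> (LINT p|T3. (cmod (f p / (of_real (E0 p) - z)))\<^sup>2) \<le> B * (LINT p|T3. (cmod (f p))\<^sup>2)"
    using free_resolvent(2)[OF z] by blast
  obtain K where K: "K \<ge> 0" "\<And>f. f \<in> L2 \<Longrightarrow> (cmod (inner_L2 f (\<alpha>\<^sub>c \<theta>)))\<^sup>2 \<le> K * (LINT p|T3. (cmod (f p))\<^sup>2)"
    using inner_alpha3_bound by blast
  have rform: "inner_L2 r (\<alpha>\<^sub>c \<theta>) = resolvent_form \<theta> z" by (simp add: r_def resolvent_form_def)
  have surj: "\<exists>f\<in>L2_sym \<theta>. (\<lambda>p. H \<theta> \<mu> f p - z * f p) =\<^sub>a\<^sub>e g" if g: "g \<in> L2_sym \<theta>" for g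
  proof -
    define h where "h = (\<lambda>p. g p / (of_real (E0 p) - z))"
    have h: "h \<in> L2_sym \<theta>" unfolding h_def by (rule free_resolvent(1)[OF z g])
    define k where "k = inner_L2 h (\<alpha>\<^sub>c \<theta>)"
    define f where "f = (\<lambda>p. 1 * h p + (- (of_real \<mu> * k / \<Delta>)) * r p)"
    have f: "f \<in> L2_sym \<theta>" unfolding f_def by (rule L2_sym_lincomb[OF h r])
    have "inner_L2 f (\<alpha>\<^sub>c \<theta>) = k - of_real \<mu> * k / \<Delta> * resolvent_form \<theta> z"
      unfolding f_def by (subst inner_alpha3_lincomb) (simp_all add: L2_sym_L2[OF h] L2_sym_L2[OF r] k_def rform)
    also have "\<dots> = k / \<Delta>"
      using \<Delta> unfolding \<Delta>_def[symmetric] by (simp add: field_simps) (simp add: \<Delta>_def algebra_simps)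
    finally have i: "inner_L2 f (\<alpha>\<^sub>c \<theta>) = k / \<Delta>" .
    have "H \<theta> \<mu> f p - z * f p = g p" for p
    proof -
      have "H \<theta> \<mu> f p - z * f p = (of_real (E0 p) - z) * f p + of_real \<mu> * (k / \<Delta>) * \<alpha>\<^sub>c \<theta> p"
        by (simp add: H_eq i algebra_simps)
      also have "(of_real (E0 p) - z) * f p = g p - of_real \<mu> * (k / \<Delta>) * \<alpha>\<^sub>c \<theta> p"
      proof -
        have "w * (1 * a + - q * b) = w * a - q * (w * b)" for w a b q :: complex
          by (simp add: algebra_simps)
        hence "(of_real (E0 p) - z) * f p = (of_real (E0 p) - z) * h p - of_real \<mu> * k / \<Delta> * ((of_real (E0 p) - z) * r p)"
          unfolding f_def by blast
        also have "(of_real (E0 p) - z) * h p = g p"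
          using ne[of p] by (simp add: h_def)
        also have "(of_real (E0 p) - z) * r p = \<alpha>\<^sub>c \<theta> p"
          using ne[of p] by (simp add: r_def)
        finally show ?thesis by simp
      qed
      finally show ?thesis by simp
    qed
    thus ?thesis using f by (auto simp: ae_eq_def)
  qed
  define A where "A = (LINT p|T3. (cmod (r p))\<^sup>2)"
  have A: "A \<ge> 0" unfolding A_def by simp
  \<comment> \<open>From f = h - (\<mu> k / \<Delta>) r: \<open>B\<close> bounds the squared norm of
    \<open>h\<close> by that of \<open>g\<close>, \<open>K\<close> bounds the square of
    \<open>k\<close> by the squared norm of \<open>h\<close>, and the factors 2 come from
    \<open>L2_lincomb\<close>.\<close>
  define C where "C = 2 * B + 2 * (cmod (of_real \<mu> / \<Delta>))\<^sup>2 * (K * B) * A"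
  have C: "C \<ge> 0" using A B(1) K(1) by (simp add: C_def)
  have bound: "norm_L2 f \<le> sqrt C * norm_L2 (\<lambda>p. H \<theta> \<mu> f p - z * f p)" if "f \<in> L2_sym \<theta>" for f
  proof -
    define N where "N = (\<lambda>g. LINT p|T3. (cmod (g p))\<^sup>2)"
    have f: "f \<in> L2" using that by (rule L2_sym_L2)
    define g where "g = (\<lambda>p. H \<theta> \<mu> f p - z * f p)"
    have g: "g \<in> L2" unfolding g_def by (rule H_shifted_L2[OF f])
    define h where "h = (\<lambda>p. g p / (of_real (E0 p) - z))"
    have h: "h \<in> L2" "N h \<le> B * N g" unfolding h_def N_def by (rule B(2,3)[OF g])+
    define k where "k = inner_L2 h (\<alpha>\<^sub>c \<theta>)"
    define s where "s = inner_L2 f (\<alpha>\<^sub>c \<theta>)"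
    have fe: "f = (\<lambda>p. 1 * h p + (- (of_real \<mu> * s)) * r p)"
    proof
      fix p
      have "(of_real (E0 p) - z) * f p = g p - of_real \<mu> * s * \<alpha>\<^sub>c \<theta> p"
        by (simp add: g_def H_eq s_def algebra_simps)
      moreover have "F = 1 * (a / w) + (- q) * (b / w)" if "w * F = a - q * b" "w \<noteq> 0" for F a b q w :: complex
        using that by (simp add: field_simps)
      ultimately show "f p = 1 * h p + (- (of_real \<mu> * s)) * r p"
        unfolding h_def r_def using ne[of p] by blast
    qed
    have "s = k - of_real \<mu> * s * resolvent_form \<theta> z"
      unfolding s_def by (subst fe, subst inner_alpha3_lincomb)
       (simp_all add: h(1) L2_sym_L2[OF r] k_def rform s_def)
    hence "s * \<Delta> = k" by (simp add: \<Delta>_def algebra_simps)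
    hence s: "s = k / \<Delta>" using \<Delta> unfolding \<Delta>_def[symmetric] by (simp add: field_simps)
    have "N f = N (\<lambda>p. 1 * h p + (- (of_real \<mu> * s)) * r p)"
      by (rule arg_cong[OF fe])
    also have "\<dots> \<le> 2 * N h + 2 * (cmod (of_real \<mu> * s))\<^sup>2 * A"
      using L2_lincomb(2)[OF h(1) L2_sym_L2[OF r], of 1 "- (of_real \<mu> * s)"]
      unfolding N_def A_def by simp
    also have "(cmod (of_real \<mu> * s))\<^sup>2 = (cmod (of_real \<mu> / \<Delta>))\<^sup>2 * (cmod k)\<^sup>2"
      by (simp add: s norm_mult norm_divide power_mult_distrib power_divide)
    also have "2 * N h + 2 * ((cmod (of_real \<mu> / \<Delta>))\<^sup>2 * (cmod k)\<^sup>2) * A \<le>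
      2 * (B * N g) + 2 * ((cmod (of_real \<mu> / \<Delta>))\<^sup>2 * (K * (B * N g))) * A"
    proof -
      have "(cmod k)\<^sup>2 \<le> K * N h" unfolding k_def N_def by (rule K(2)[OF h(1)])
      also have "\<dots> \<le> K * (B * N g)" by (intro mult_left_mono h(2) K(1))
      finally show ?thesis using h(2) A by (intro add_mono mult_left_mono mult_right_mono) auto
    qed
    also have "\<dots> = C * N g" by (simp add: C_def algebra_simps)
    finally have "sqrt (N f) \<le> sqrt (C * N g)" by simp
    thus ?thesis unfolding norm_L2_def N_def g_def real_sqrt_mult .
  qed
  show ?thesis
    unfolding resolvent_set_def using surj bound by blast
qed

section \<open>Eigenvalues and eigenfunctions off the continuum\<close>

lemma eigenfunction_form:
  assumes z: "z \<notin> continuum" and f: "f \<in> eigenspace (L2_sym \<theta>) (H \<theta> \<mu>) z"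
  shows "f =\<^sub>a\<^sub>e (\<lambda>p. - (of_real \<mu> * inner_L2 f (\<alpha>\<^sub>c \<theta>)) * (\<alpha>\<^sub>c \<theta> p / (of_real (E0 p) - z)))"
proof -
  have "AE p in T3. H \<theta> \<mu> f p = z * f p" using f by (simp add: eigenspace_def ae_eq_def)
  thus ?thesis unfolding ae_eq_def
  proof eventually_elim
    case (elim p)
    hence "(of_real (E0 p) - z) * f p = - (of_real \<mu> * inner_L2 f (\<alpha>\<^sub>c \<theta>) * \<alpha>\<^sub>c \<theta> p)"
      unfolding H_eq by (simp add: left_diff_distrib) (metis add_diff_cancel_left' diff_add_cancel minus_diff_eq)
    thus ?case using E0_neq[OF z, of p] by (simp add: field_simps)
  qed
qed

text \<open>Pairing the explicit form of an eigenfunction with \<open>alpha3\<close> gives s (1 +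
  \<mu> F(z)) = 0, where s is the pairing of the eigenfunction. If s vanished, so would the
  eigenfunction.\<close>

lemma eigenvalue_imp_zero:
  assumes z: "z \<notin> continuum" and ev: "eigenvalue (L2_sym \<theta>) (H \<theta> \<mu>) z"
  shows "1 + of_real \<mu> * resolvent_form \<theta> z = 0"
proof -
  obtain f where f: "f \<in> eigenspace (L2_sym \<theta>) (H \<theta> \<mu>) z" "\<not> f =\<^sub>a\<^sub>e (\<lambda>p. 0)"
    using ev by (auto simp: eigenvalue_def eigenfunction_def)
  define r where "r = (\<lambda>p. \<alpha>\<^sub>c \<theta> p / (of_real (E0 p) - z))"
  define s where "s = inner_L2 f (\<alpha>\<^sub>c \<theta>)"
  have r: "r \<in> L2" unfolding r_def by (rule L2_sym_L2[OF free_resolvent(1)[OF z alpha3_L2_sym]])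
  \<comment> \<open>The zero summand brings the right-hand side into the shape of the rules for
    linear combinations.\<close>
  have eq: "f =\<^sub>a\<^sub>e (\<lambda>p. - (of_real \<mu> * s) * r p + 0 * r p)"
    using eigenfunction_form[OF z f(1)] by (simp add: r_def s_def)
  have fL: "f \<in> L2" using f(1) L2_sym_L2 by (auto simp: eigenspace_def)
  have s: "s = - (of_real \<mu> * s) * resolvent_form \<theta> z"
    using inner_alpha3_cong[OF fL L2_lincomb(1)[OF r r] eq, of \<theta>] inner_alpha3_lincomb[OF r r, of "- (of_real \<mu> * s)" 0 \<theta>]
    by (simp add: s_def[symmetric] resolvent_form_def r_def[symmetric])
  have "s * (1 + of_real \<mu> * resolvent_form \<theta> z) = s - (- (of_real \<mu> * s) * resolvent_form \<theta> z)"
    by (simp add: algebra_simps)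
  also have "\<dots> = 0" using s by (simp only: right_minus_eq)
  finally have "s * (1 + of_real \<mu> * resolvent_form \<theta> z) = 0" .
  moreover have "s \<noteq> 0" using eq f(2) by auto
  ultimately show ?thesis by simp
qed

text \<open>For this function (E0 - z) f is c \<open>alpha3\<close>, while the rank one term is
  \<mu> c F(z) \<open>alpha3\<close>, that is -c \<open>alpha3\<close>; the two cancel.\<close>

lemma zero_imp_eigenfunction:
  assumes z: "z \<notin> continuum" and \<Delta>: "1 + of_real \<mu> * resolvent_form \<theta> z = 0" and c: "c \<noteq> 0"
  shows "eigenfunction (L2_sym \<theta>) (H \<theta> \<mu>) z (\<lambda>p. c * (\<alpha>\<^sub>c \<theta> p / (of_real (E0 p) - z)))"
proof -
  define r where "r = (\<lambda>p. \<alpha>\<^sub>c \<theta> p / (of_real (E0 p) - z))"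
  define f where "f = (\<lambda>p. c * r p + 0 * r p)"
  have r: "r \<in> L2_sym \<theta>" unfolding r_def by (rule free_resolvent(1)[OF z alpha3_L2_sym])
  have f: "f \<in> L2_sym \<theta>" unfolding f_def by (rule L2_sym_lincomb[OF r r])
  have i: "inner_L2 f (\<alpha>\<^sub>c \<theta>) = c * resolvent_form \<theta> z"
    unfolding f_def using inner_alpha3_lincomb[OF L2_sym_L2[OF r] L2_sym_L2[OF r], of c 0 \<theta>]
    by (simp add: resolvent_form_def r_def[symmetric])
  have \<mu>: "of_real \<mu> * resolvent_form \<theta> z = - 1" using \<Delta> by (simp add: eq_neg_iff_add_eq_0 add.commute)
  have "H \<theta> \<mu> f p = z * f p" for p
  proof -
    have "H \<theta> \<mu> f p = of_real (E0 p) * f p + (of_real \<mu> * resolvent_form \<theta> z) * c * \<alpha>\<^sub>c \<theta> p"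
      by (simp add: H_eq i)
    also have "\<dots> = of_real (E0 p) * f p - (of_real (E0 p) - z) * f p"
      unfolding \<mu> using E0_neq[OF z, of p] by (simp add: f_def r_def)
    finally show ?thesis by (simp add: algebra_simps)
  qed
  \<comment> \<open>Its pairing with \<open>alpha3\<close> is c F(z), and F(z) cannot vanish because
    \<mu> F(z) = -1.\<close>
  moreover have "\<not> f =\<^sub>a\<^sub>e (\<lambda>p. 0)"
  proof
    assume "f =\<^sub>a\<^sub>e (\<lambda>p. 0)"
    moreover have "(\<lambda>p. 0) \<in> L2" by (simp add: L2_def)
    ultimately have "inner_L2 f (\<alpha>\<^sub>c \<theta>) = inner_L2 (\<lambda>p. 0) (\<alpha>\<^sub>c \<theta>)"
      by (intro inner_alpha3_cong L2_sym_L2[OF f])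
    hence "c * resolvent_form \<theta> z = 0" by (simp add: i) (simp add: inner_L2_def)
    thus False using c \<mu> by auto
  qed
  ultimately have "eigenfunction (L2_sym \<theta>) (H \<theta> \<mu>) z f"
    using f by (simp add: eigenfunction_def eigenspace_def ae_eq_def)
  thus ?thesis by (simp add: f_def r_def)
qed

lemma eigenvalue_iff:
  assumes "z \<notin> continuum"
  shows "eigenvalue (L2_sym \<theta>) (H \<theta> \<mu>) z \<longleftrightarrow> 1 + of_real \<mu> * resolvent_form \<theta> z = 0"
  using eigenvalue_imp_zero[OF assms] zero_imp_eigenfunction[OF assms _ one_neq_zero]
  unfolding eigenvalue_def by blast

lemma eigenspace_dim_1:
  assumes z: "z \<notin> continuum" and ev: "eigenvalue (L2_sym \<theta>) (H \<theta> \<mu>) z"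
  shows "has_dim (eigenspace (L2_sym \<theta>) (H \<theta> \<mu>) z) 1"
proof -
  define r where "r = (\<lambda>p. \<alpha>\<^sub>c \<theta> p / (of_real (E0 p) - z))"
  have r: "eigenfunction (L2_sym \<theta>) (H \<theta> \<mu>) z r"
    using zero_imp_eigenfunction[OF z eigenvalue_imp_zero[OF z ev] one_neq_zero] by (simp add: r_def)
  have "\<exists>c. f =\<^sub>a\<^sub>e (\<lambda>p. c * r p)" if "f \<in> eigenspace (L2_sym \<theta>) (H \<theta> \<mu>) z" for f
    using eigenfunction_form[OF z that] unfolding r_def by blast
  moreover have "c = 0" if "(\<lambda>p. c * r p) =\<^sub>a\<^sub>e (\<lambda>p. 0)" for c
  proof (rule ccontr)
    assume "c \<noteq> 0"
    hence "r =\<^sub>a\<^sub>e (\<lambda>p. 0)" using that by (simp add: ae_eq_def)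
    thus False using r by (simp add: eigenfunction_def)
  qed
  ultimately show ?thesis
    using r unfolding has_dim_def eigenfunction_def
    by (intro exI[of _ "\<lambda>_. r"]) (auto intro: exI[of _ "\<lambda>_. _"])
qed

text \<open>A zero of the determinant forces \<mu> to be nonzero, so \<open>eigenfun\<close> does
  not degenerate. It is linear in \<open>c\<close>, and the reciprocal of its norm at
  \<open>c = 1\<close> normalizes it.\<close>

lemma eigenfun_normalized:
  assumes z: "of_real x \<notin> continuum" and ev: "eigenvalue (L2_sym \<theta>) (H \<theta> \<mu>) (of_real x)"
  shows "\<exists>c. eigenfunction (L2_sym \<theta>) (H \<theta> \<mu>) (of_real x) (eigenfun \<theta> \<mu> x c) \<and>
           norm_L2 (eigenfun \<theta> \<mu> x c) = 1"
proof -
  note \<Delta> = eigenvalue_imp_zero[OF z ev]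
  have \<mu>: "\<mu> \<noteq> 0" using \<Delta> by auto
  have e: "eigenfun \<theta> \<mu> x c = (\<lambda>p. (- of_real \<mu> * c) * (\<alpha>\<^sub>c \<theta> p / (of_real (E0 p) - of_real x)))" for c
    by (simp add: eigenfun_def)
  have ef: "eigenfunction (L2_sym \<theta>) (H \<theta> \<mu>) (of_real x) (eigenfun \<theta> \<mu> x c)" if "c \<noteq> 0" for c
    unfolding e by (rule zero_imp_eigenfunction[OF z \<Delta>]) (use \<mu> that in simp)
  define n where "n = norm_L2 (eigenfun \<theta> \<mu> x 1)"
  have "eigenfun \<theta> \<mu> x 1 \<in> L2" "\<not> eigenfun \<theta> \<mu> x 1 =\<^sub>a\<^sub>e (\<lambda>p. 0)"
    using ef[of 1] L2_sym_L2 by (auto simp: eigenfunction_def eigenspace_def)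
  hence "n \<noteq> 0" by (simp add: n_def norm_L2_eq_0_iff)
  moreover have "n \<ge> 0" by (simp add: n_def norm_L2_def)
  ultimately have n: "n > 0" by simp
  have "norm_L2 (eigenfun \<theta> \<mu> x (of_real (1 / n))) = n / n"
  proof -
    have "eigenfun \<theta> \<mu> x (of_real (1 / n)) p = of_real (1 / n) * eigenfun \<theta> \<mu> x 1 p" for p
      by (simp add: eigenfun_def)
    hence "(cmod (eigenfun \<theta> \<mu> x (of_real (1 / n)) p))\<^sup>2 = (1 / n)\<^sup>2 * (cmod (eigenfun \<theta> \<mu> x 1 p))\<^sup>2" for p
      using n by (simp only: norm_mult power_mult_distrib norm_of_real power2_abs)
    hence "norm_L2 (eigenfun \<theta> \<mu> x (of_real (1 / n))) = sqrt ((1 / n)\<^sup>2) * n"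
      by (simp only: norm_L2_def n_def integral_mult_right_zero real_sqrt_mult)
    thus ?thesis using n by simp
  qed
  thus ?thesis using n ef[of "of_real (1 / n)"] by (intro exI[of _ "of_real (1 / n)"]) simp
qed

section \<open>The essential spectrum\<close>

text \<open>A Weyl sequence is obtained from multiples of \<open>\<alpha>\<^sub>3\<close> that are supported on thin layers around
  a level set of \<open>E0\<close>; combining two adjacent layers makes the function orthogonal to \<open>\<alpha>\<^sub>3\<close>.\<close>

lemma continuum_subset_spectrum: "continuum \<subseteq> op_spectrum (L2_sym \<theta>) (H \<theta> \<mu>)"
proof (rule subsetI, unfold op_spectrum_def, rule ComplI)
  fix z assume "z \<in> continuum" and res: "z \<in> resolvent_set (L2_sym \<theta>) (H \<theta> \<mu>)"
  then obtain x where x: "z = of_real x" "0 \<le> x" "x \<le> 24" by (auto simp: continuum_def)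
  from res obtain C where C: "\<And>f. f \<in> L2_sym \<theta> \<Longrightarrow> norm_L2 f \<le> C * norm_L2 (\<lambda>p. H \<theta> \<mu> f p - z * f p)"
    unfolding resolvent_set_def by blast
  \<comment> \<open>Chosen to make \<open>\<bar>C\<bar> * \<epsilon> < 1\<close>: an approximate
    eigenfunction with relative error \<epsilon> then violates the resolvent estimate. The absolute
    value covers either sign of \<open>C\<close>.\<close>
  define \<epsilon> where "\<epsilon> = 1 / (\<bar>C\<bar> + 1)"
  have \<epsilon>: "\<epsilon> > 0" "\<bar>C\<bar> * \<epsilon> < 1" by (auto simp: \<epsilon>_def field_simps)
  \<comment> \<open>Clipping to [0, 24] leaves a nondegenerate interval even when \<open>x\<close>
    is an endpoint.\<close>
  define a c where "a = max 0 (x - \<epsilon>)" and "c = min 24 (x + \<epsilon>)"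
  define b where "b = (a + c) / 2"
  have ac: "0 \<le> a" "a < c" "c \<le> 24" "x - \<epsilon> \<le> a" "c \<le> x + \<epsilon>"
    using x \<epsilon>(1) by (auto simp: a_def c_def)
  have b: "a < b" "b < c" using ac(2) by (auto simp: b_def)
  define m1 where "m1 = (LINT p|T3. indicator {a<..<b} (E0 p) * (alpha3 \<theta> p)\<^sup>2)"
  define m2 where "m2 = (LINT p|T3. indicator {b<..<c} (E0 p) * (alpha3 \<theta> p)\<^sup>2)"
  have m: "m1 > 0" "m2 > 0"
    unfolding m1_def m2_def using ac b by (auto intro!: level_set_integral_pos)
  have int: "integrable T3 (\<lambda>p. indicator J (E0 p) * (alpha3 \<theta> p)\<^sup>2)" if [measurable]: "J \<in> sets borel" for J
    by (rule integrable_T3_bounded[where B = 576]) (auto simp: indicator_def alpha3_sq_bound)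
  \<comment> \<open>Each layer is weighted by the mass of the other, so the pairing with
    \<open>alpha3\<close> is m2 m1 - m1 m2.\<close>
  define \<phi> :: "real \<Rightarrow> real" where "\<phi> = (\<lambda>y. m2 * indicator {a<..<b} y - m1 * indicator {b<..<c} y)"
  have \<phi>m: "(\<lambda>y. complex_of_real (\<phi> y)) \<in> borel_measurable borel" unfolding \<phi>_def by measurable
  have \<phi>b: "cmod (complex_of_real (\<phi> y)) \<le> m1 + m2" for y
    using m by (auto simp: \<phi>_def indicator_def)
  have \<phi>0: "\<phi> y = 0" if "\<not> (a < y \<and> y < c)" for y
    using that b by (auto simp: \<phi>_def indicator_def)
  define f where "f = (\<lambda>p. complex_of_real (\<phi> (E0 p)) * \<alpha>\<^sub>c \<theta> p)"
  have f: "f \<in> L2_sym \<theta>" unfolding f_def by (rule L2_sym_E0_mult[OF alpha3_L2_sym \<phi>m \<phi>b])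
  have "inner_L2 f (\<alpha>\<^sub>c \<theta>) = (LINT p|T3. complex_of_real (m2 * (indicator {a<..<b} (E0 p) * (alpha3 \<theta> p)\<^sup>2) - m1 * (indicator {b<..<c} (E0 p) * (alpha3 \<theta> p)\<^sup>2)))"
    unfolding inner_alpha3 f_def \<phi>_def by (simp add: power2_eq_square algebra_simps)
  also have "\<dots> = of_real (m2 * m1 - m1 * m2)"
    unfolding integral_complex_of_real by (simp add: int m1_def m2_def)
  finally have orth: "inner_L2 f (\<alpha>\<^sub>c \<theta>) = 0" by simp
  have N: "integrable T3 (\<lambda>p. (cmod (f p))\<^sup>2)" by (rule L2_square_integrable[OF L2_sym_L2[OF f]])
  have "0 < m2\<^sup>2 * m1" using m by simp
  also have "\<dots> = (LINT p|T3. m2\<^sup>2 * (indicator {a<..<b} (E0 p) * (alpha3 \<theta> p)\<^sup>2))"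
    by (simp add: m1_def)
  also have "\<dots> \<le> (LINT p|T3. (cmod (f p))\<^sup>2)"
    using b by (intro integral_mono N integrable_mult_right int)
      (auto simp: f_def \<phi>_def indicator_def norm_mult power_mult_distrib)
  finally have pos: "norm_L2 f > 0" by (simp add: norm_L2_def)
  have le: "(cmod (H \<theta> \<mu> f p - z * f p))\<^sup>2 \<le> \<epsilon>\<^sup>2 * (cmod (f p))\<^sup>2" for p
  proof (cases "a < E0 p \<and> E0 p < c")
    case True
    have "H \<theta> \<mu> f p - z * f p = of_real (E0 p - x) * f p"
      by (simp add: H_eq orth x(1) algebra_simps)
    moreover have "\<bar>E0 p - x\<bar> \<le> \<epsilon>" using True ac by auto
    hence "(E0 p - x)\<^sup>2 \<le> \<epsilon>\<^sup>2" using \<epsilon>(1) by (intro abs_le_square_iff[THEN iffD1]) auto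
    ultimately show ?thesis
      by (simp only: norm_mult power_mult_distrib norm_of_real power2_abs) (intro mult_right_mono, auto)
  next
    case False
    hence "f p = 0" by (simp add: f_def \<phi>0)
    thus ?thesis by (simp add: H_eq orth)
  qed
  have "(LINT p|T3. (cmod (H \<theta> \<mu> f p - z * f p))\<^sup>2) \<le> (LINT p|T3. \<epsilon>\<^sup>2 * (cmod (f p))\<^sup>2)"
    using N by (intro integral_mono L2_square_integrable H_shifted_L2 L2_sym_L2[OF f] le) simp
  also have "\<dots> = \<epsilon>\<^sup>2 * (LINT p|T3. (cmod (f p))\<^sup>2)" by simp
  finally have "norm_L2 (\<lambda>p. H \<theta> \<mu> f p - z * f p) \<le> sqrt (\<epsilon>\<^sup>2 * (LINT p|T3. (cmod (f p))\<^sup>2))"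
    by (simp add: norm_L2_def)
  also have "\<dots> = \<epsilon> * norm_L2 f" using \<epsilon>(1) by (simp add: norm_L2_def real_sqrt_mult)
  finally have "C * norm_L2 (\<lambda>p. H \<theta> \<mu> f p - z * f p) \<le> \<bar>C\<bar> * (\<epsilon> * norm_L2 f)"
    by (intro mult_mono) (auto simp: norm_L2_def)
  with C[OF f] have "norm_L2 f \<le> (\<bar>C\<bar> * \<epsilon>) * norm_L2 f" by simp
  also have "\<dots> < 1 * norm_L2 f" using pos \<epsilon>(2) by (intro mult_strict_right_mono)
  finally show False by simp
qed

section \<open>Reality of the zeros, and the essential spectrum given finitely many of them\<close>

lemma resolvent_form_of_real:
  "resolvent_form \<theta> (of_real x) = of_real (LINT p|T3. (alpha3 \<theta> p)\<^sup>2 / (E0 p - x))"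
proof -
  have "resolvent_form \<theta> (of_real x) = (LINT p|T3. complex_of_real ((alpha3 \<theta> p)\<^sup>2 / (E0 p - x)))"
    unfolding resolvent_form_def inner_alpha3 by (simp add: power2_eq_square)
  thus ?thesis by (simp only: integral_complex_of_real)
qed

lemma zero_imp_real:
  assumes z: "z \<notin> continuum" and \<Delta>: "1 + of_real \<mu> * resolvent_form \<theta> z = 0"
  shows "z = of_real (Re z)"
proof (rule ccontr)
  assume "z \<noteq> of_real (Re z)"
  hence y: "Im z \<noteq> 0" by (simp add: complex_eq_iff)
  \<comment> \<open>\<open>w p\<close> is the squared modulus of \<open>E0 p - z\<close>, the
    denominator in the imaginary part of the resolvent integrand. Its lower bound makes the integral
    of the quotient converge; its upper bound \<open>M\<close> keeps that integral strictly
    positive.\<close>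
  define w where "w = (\<lambda>p. (E0 p - Re z)\<^sup>2 + (Im z)\<^sup>2)"
  define M where "M = (24 + \<bar>Re z\<bar>)\<^sup>2 + (Im z)\<^sup>2"
  have wm [measurable]: "w \<in> borel_measurable borel" unfolding w_def by measurable
  have w: "(Im z)\<^sup>2 \<le> w p" "w p \<le> M" "0 < w p" for p
  proof -
    have "\<bar>E0 p - Re z\<bar> \<le> \<bar>24 + \<bar>Re z\<bar>\<bar>" using E0_bounds[of p] by linarith
    hence "(E0 p - Re z)\<^sup>2 \<le> (24 + \<bar>Re z\<bar>)\<^sup>2" by (simp only: abs_le_square_iff)
    thus "w p \<le> M" by (simp add: w_def M_def)
    show "(Im z)\<^sup>2 \<le> w p" by (simp add: w_def)
    thus "0 < w p" using y by (smt (verit) zero_less_power2)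
  qed
  have int: "integrable T3 (\<lambda>p. (alpha3 \<theta> p)\<^sup>2 / w p)"
  proof (rule integrable_T3_bounded[where B = "576 / (Im z)\<^sup>2"])
    fix p
    show "norm ((alpha3 \<theta> p)\<^sup>2 / w p) \<le> 576 / (Im z)\<^sup>2"
      using w(1,3)[of p] y alpha3_sq_bound by (simp add: abs_divide) (intro frac_le, auto)
  qed measurable
  have "0 < (LINT p|T3. (alpha3 \<theta> p)\<^sup>2) / M"
    using alpha3_norm_pos w(2,3)[of 0] by (intro divide_pos_pos) auto
  also have "\<dots> = (LINT p|T3. (alpha3 \<theta> p)\<^sup>2 / M)" by simp
  also have "\<dots> \<le> (LINT p|T3. (alpha3 \<theta> p)\<^sup>2 / w p)"
    using w by (intro integral_mono int divide_left_mono mult_pos_pos)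
      (auto simp: alpha3_integrable intro: less_le_trans)
  finally have pos: "0 < (LINT p|T3. (alpha3 \<theta> p)\<^sup>2 / w p)" .
  define r where "r = (\<lambda>p. \<alpha>\<^sub>c \<theta> p / (of_real (E0 p) - z))"
  have "r \<in> L2" unfolding r_def by (rule L2_sym_L2[OF free_resolvent(1)[OF z alpha3_L2_sym]])
  hence ri: "integrable T3 (\<lambda>p. r p * \<alpha>\<^sub>c \<theta> p)" by (intro L2_integrable L2_mult_alpha3)
  have "Im (resolvent_form \<theta> z) = (LINT p|T3. Im (r p * \<alpha>\<^sub>c \<theta> p))"
    unfolding resolvent_form_def inner_alpha3 r_def[symmetric] by (rule integral_Im[OF ri, symmetric])
  also have "(\<lambda>p. Im (r p * \<alpha>\<^sub>c \<theta> p)) = (\<lambda>p. Im z * ((alpha3 \<theta> p)\<^sup>2 / w p))"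
    by (auto simp: r_def w_def Im_divide power2_eq_square)
  finally have "Im (resolvent_form \<theta> z) = Im z * (LINT p|T3. (alpha3 \<theta> p)\<^sup>2 / w p)" 
    by (simp only: integral_mult_right_zero)
  moreover have "\<mu> * Im (resolvent_form \<theta> z) = 0" using arg_cong[OF \<Delta>, of Im] by simp
  moreover have "\<mu> \<noteq> 0" using \<Delta> by auto
  ultimately show False using y pos by simp
qed

text \<open>Off the continuum the spectrum lies in the finite zero set, so its points there are
  isolated eigenvalues of multiplicity one. Every point of the continuum is a limit point of the
  spectrum and cannot be discrete, whether or not it is an eigenvalue.\<close>

lemma essential_spectrum_H:
  assumes fin: "finite {z. z \<notin> continuum \<and> 1 + of_real \<mu> * resolvent_form \<theta> z = 0}"
  shows "essential_spectrum (L2_sym \<theta>) (H \<theta> \<mu>) = continuum"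
proof -
  define S where "S = op_spectrum (L2_sym \<theta>) (H \<theta> \<mu>)"
  define Z where "Z = {z. z \<notin> continuum \<and> 1 + of_real \<mu> * resolvent_form \<theta> z = 0}"
  have SZ: "S \<subseteq> continuum \<union> Z"
    unfolding S_def Z_def op_spectrum_def using regular_point_resolvent by blast
  have CS: "continuum \<subseteq> S" unfolding S_def by (rule continuum_subset_spectrum)
  have closed: "closed continuum"
    unfolding continuum_def by (intro compact_imp_closed compact_continuous_image continuous_intros) auto
  have "connected continuum"
    unfolding continuum_def by (intro connected_continuous_image continuous_intros) auto
  moreover have "continuum \<noteq> {x}" for x
  proof -
    have "0 \<in> continuum" "1 \<in> continuum"
      unfolding continuum_def by (auto intro: image_eqI[of _ _ 0] image_eqI[of _ _ 1])
    thus ?thesis by (metis singletonD zero_neq_one)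
  qed
  \<comment> \<open>A connected set with more than one point has no isolated points.\<close>
  ultimately have limpt: "z islimpt S" if "z \<in> continuum" for z
    using that connected_imp_perfect islimpt_subset[OF _ CS] by blast
  have disc: "z \<in> discrete_spectrum (L2_sym \<theta>) (H \<theta> \<mu>)" if "z \<in> S" "z \<notin> continuum" for z
  proof -
    have "\<not> z islimpt continuum \<union> Z"
      using fin that(2) closed by (auto simp: islimpt_Un islimpt_finite Z_def closed_limpt)
    hence nl: "\<not> z islimpt S" using SZ islimpt_subset by blast
    have "eigenvalue (L2_sym \<theta>) (H \<theta> \<mu>) z"
      using that SZ eigenvalue_iff by (auto simp: Z_def)
    thus ?thesis
      using nl that eigenspace_dim_1 unfolding discrete_spectrum_def S_def by blast
  qed
  show ?thesis
    unfolding essential_spectrum_def S_def[symmetric]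
    using limpt disc CS by (auto simp: discrete_spectrum_def S_def[symmetric])
qed

section \<open>Zeros of the Fredholm determinant\<close>

text \<open>Both gaps are treated at once: \<open>E\<close> is \<open>E0\<close> below and \<open>24 - E0\<close> above the continuum, and \<open>t\<close> is
  the distance to it.\<close>

locale dispersion =
  fixes E :: "real^3 \<Rightarrow> real" and \<theta> :: symmetry
  assumes E_measurable [measurable]: "E \<in> borel_measurable borel"
    and E_le: "E p \<le> 24" and alpha3_le_E: "\<bar>alpha3 \<theta> p\<bar> \<le> E p"
begin

text \<open>For \<open>E0\<close> this is F(-t), for \<open>24 - E0\<close> it is -F(24 + t), with F
  the resolvent form; at \<open>t = 0\<close> it is the threshold integral.\<close>

definition G :: "real \<Rightarrow> real" where
  "G t = (LINT p|T3. (alpha3 \<theta> p)\<^sup>2 / (E p + t))"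

lemma E_nonneg: "0 \<le> E p"
  using alpha3_le_E[of p] by linarith

text \<open>The bound of \<open>alpha3\<close> by \<open>E\<close> keeps the integrand bounded even
  at \<open>t = 0\<close>, where the denominator may vanish.\<close>

lemma G_integrable:
  assumes "t \<ge> 0" shows "integrable T3 (\<lambda>p. (alpha3 \<theta> p)\<^sup>2 / (E p + t))"
proof (rule integrable_T3_bounded[where B = 24])
  fix p
  show "norm ((alpha3 \<theta> p)\<^sup>2 / (E p + t)) \<le> 24"
  proof (cases "E p + t = 0")
    case False
    hence "E p + t > 0" using E_nonneg[of p] assms by linarith
    moreover have "(alpha3 \<theta> p)\<^sup>2 \<le> 24 * (E p + t)"
      using mult_mono[OF alpha3_bound order_trans[OF alpha3_le_E], of p "E p + t" \<theta> p] assms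
      by (simp add: power2_eq_square abs_mult[symmetric])
    ultimately show ?thesis by (simp add: field_simps)
  qed simp
qed measurable

text \<open>The difference equals (t - s) \<open>alpha3\<close>^2 / ((E + s) (E + t)). Bounding the
  denominator above by (24 + t)^2 yields strict decrease of \<open>G\<close>; bounding it below by
  \<open>alpha3\<close>^2 yields a Lipschitz constant valid up to the threshold.\<close>

lemma G_diff_bounds:
  assumes "0 \<le> s" "s < t"
  shows "(t - s) / (24 + t)\<^sup>2 * (alpha3 \<theta> p)\<^sup>2 \<le> (alpha3 \<theta> p)\<^sup>2 / (E p + s) - (alpha3 \<theta> p)\<^sup>2 / (E p + t)" (is ?lo)
    and "(alpha3 \<theta> p)\<^sup>2 / (E p + s) - (alpha3 \<theta> p)\<^sup>2 / (E p + t) \<le> t - s" (is ?hi)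
proof -
  note E = E_nonneg[of p] E_le[of p]
  have "?lo \<and> ?hi"
  proof (cases "E p + s = 0")
    \<comment> \<open>Here \<open>E p\<close> and \<open>s\<close> are both 0, which forces
      \<open>alpha3\<close> to vanish at \<open>p\<close>, and all quotients are 0.\<close>
    case True
    hence "alpha3 \<theta> p = 0" using E(1) assms(1) alpha3_le_E[of p] by simp
    thus ?thesis using assms by simp
  next
    case False
    hence pos: "E p + s > 0" "E p + t > 0" using E assms by linarith+
    define q where "q = (E p + s) * (E p + t)"
    have q: "q > 0" using pos by (simp add: q_def)
    have eq: "(alpha3 \<theta> p)\<^sup>2 / (E p + s) - (alpha3 \<theta> p)\<^sup>2 / (E p + t) = (t - s) * ((alpha3 \<theta> p)\<^sup>2 / q)"
      using pos by (simp add: q_def field_simps)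
    have "q \<le> (24 + t)\<^sup>2"
      unfolding q_def power2_eq_square using E assms pos by (intro mult_mono) auto
    hence "(alpha3 \<theta> p)\<^sup>2 / (24 + t)\<^sup>2 \<le> (alpha3 \<theta> p)\<^sup>2 / q"
      using q by (intro divide_left_mono mult_pos_pos) (auto intro: less_le_trans)
    hence "(t - s) * ((alpha3 \<theta> p)\<^sup>2 / (24 + t)\<^sup>2) \<le> (t - s) * ((alpha3 \<theta> p)\<^sup>2 / q)"
      using assms by (intro mult_left_mono) auto
    hence ?lo by (simp add: eq)
    moreover have "(alpha3 \<theta> p)\<^sup>2 \<le> q"
    proof -
      have "\<bar>alpha3 \<theta> p\<bar> * \<bar>alpha3 \<theta> p\<bar> \<le> (E p + s) * (E p + t)"
        using alpha3_le_E[of p] assms pos by (intro mult_mono) auto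
      thus ?thesis by (simp add: q_def power2_eq_square)
    qed
    hence "(alpha3 \<theta> p)\<^sup>2 / q \<le> 1" using q by simp
    hence "(t - s) * ((alpha3 \<theta> p)\<^sup>2 / q) \<le> (t - s) * 1" using assms by (intro mult_left_mono) auto
    hence ?hi by (simp add: eq)
    ultimately show ?thesis by blast
  qed
  thus ?lo ?hi by auto
qed

lemma G_strict_antimono:
  assumes "0 \<le> s" "s < t" shows "G t < G s"
proof -
  have "0 < (t - s) / (24 + t)\<^sup>2 * (LINT p|T3. (alpha3 \<theta> p)\<^sup>2)"
    using assms alpha3_norm_pos by (intro mult_pos_pos divide_pos_pos) auto
  also have "\<dots> = (LINT p|T3. (t - s) / (24 + t)\<^sup>2 * (alpha3 \<theta> p)\<^sup>2)" by simp
  also have "\<dots> \<le> (LINT p|T3. (alpha3 \<theta> p)\<^sup>2 / (E p + s) - (alpha3 \<theta> p)\<^sup>2 / (E p + t))"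
    using assms by (intro integral_mono G_diff_bounds(1) integrable_mult_right alpha3_integrable
      Bochner_Integration.integrable_diff G_integrable) auto
  also have "\<dots> = G s - G t"
    unfolding G_def using assms by (intro Bochner_Integration.integral_diff G_integrable) auto
  finally show ?thesis by simp
qed

lemma G_continuous: "continuous_on {0..} G"
proof -
  define m where "m = measure T3 (space T3)"
  have *: "G s - G t \<le> m * (t - s)" if "0 \<le> s" "s < t" for s t
  proof -
    have "G s - G t = (LINT p|T3. (alpha3 \<theta> p)\<^sup>2 / (E p + s) - (alpha3 \<theta> p)\<^sup>2 / (E p + t))"
      unfolding G_def using that by (intro Bochner_Integration.integral_diff[symmetric] G_integrable) auto
    also have "\<dots> \<le> (LINT p|T3. t - s)"
      using that by (intro integral_mono G_diff_bounds(2)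
        Bochner_Integration.integrable_diff G_integrable) auto
    finally show ?thesis by (simp add: m_def)
  qed
  have "m-lipschitz_on {0..} G"
  proof (rule lipschitz_onI)
    fix s t :: real assume st: "s \<in> {0..}" "t \<in> {0..}"
    show "dist (G s) (G t) \<le> m * dist s t"
    proof (cases s t rule: linorder_cases)
      case less
      thus ?thesis using *[of s t] G_strict_antimono[of s t] st by (simp add: dist_real_def)
    next
      case greater
      thus ?thesis using *[of t s] G_strict_antimono[of t s] st by (simp add: dist_real_def)
    qed simp
  qed (simp add: m_def)
  thus ?thesis by (rule lipschitz_on_continuous_on)
qed

text \<open>Strict decrease towards a nonnegative value.\<close>

lemma G_pos: "t \<ge> 0 \<Longrightarrow> G t > 0"
proof -
  assume t: "t \<ge> 0"
  have "0 \<le> G (t + 1)"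
    unfolding G_def using E_nonneg t by (intro integral_nonneg_AE AE_I2 divide_nonneg_nonneg) (auto intro: add_nonneg_nonneg)
  also have "\<dots> < G t" using t by (intro G_strict_antimono) auto
  finally show ?thesis .
qed

lemma G_le:
  assumes "t > 0" shows "G t \<le> (LINT p|T3. (alpha3 \<theta> p)\<^sup>2) / t"
proof -
  have "G t \<le> (LINT p|T3. (alpha3 \<theta> p)\<^sup>2 / t)"
    unfolding G_def using assms E_nonneg
    by (intro integral_mono G_integrable integrable_divide alpha3_integrable divide_left_mono)
      (auto intro!: mult_pos_pos add_nonneg_pos)
  thus ?thesis by simp
qed

text \<open>The parameter \<nu> stands for -\<mu> below the continuum and for \<mu> above it, which
  gives the determinant equation the same form in both gaps.\<close>

definition zeros :: "real \<Rightarrow> real set" where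
  "zeros \<nu> = {t. t > 0 \<and> \<nu> * G t = 1}"

lemma zeros_unique: "s \<in> zeros \<nu> \<Longrightarrow> t \<in> zeros \<nu> \<Longrightarrow> s = t"
proof (rule ccontr)
  assume "s \<in> zeros \<nu>" "t \<in> zeros \<nu>" "s \<noteq> t"
  hence "\<nu> * G s = \<nu> * G t" "\<nu> \<noteq> 0" "0 < s" "0 < t" by (auto simp: zeros_def)
  thus False using G_strict_antimono[of s t] G_strict_antimono[of t s] \<open>s \<noteq> t\<close> by force
qed

lemma finite_zeros: "finite (zeros \<nu>)"
proof (cases "zeros \<nu> = {}")
  case False
  then obtain t where "t \<in> zeros \<nu>" by blast
  hence "zeros \<nu> \<subseteq> {t}" using zeros_unique by blast
  thus ?thesis by (rule finite_subset) simp
qed simp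

text \<open>A zero at positive \<open>t\<close> forces \<nu> = 1 / G t, which exceeds 1 / G 0 by
  strict decrease.\<close>

lemma card_zeros_small:
  assumes "\<nu> < 1 / G 0" shows "card (zeros \<nu>) = 0"
proof -
  have "\<nu> * G t \<noteq> 1" if t: "t > 0" for t
  proof
    assume eq: "\<nu> * G t = 1"
    hence "\<nu> = 1 / G t" using G_pos[of t] t by (simp add: field_simps)
    moreover have "1 / G 0 < 1 / G t"
      using G_pos[of t] G_strict_antimono[of 0 t] t by (intro divide_strict_left_mono mult_pos_pos) auto
    ultimately show False using assms by simp
  qed
  hence "zeros \<nu> = {}" by (auto simp: zeros_def)
  thus ?thesis by simp
qed

lemma card_zeros_large:
  assumes "\<nu> > 1 / G 0" shows "card (zeros \<nu>) = 1"
proof -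
  define A where "A = (LINT p|T3. (alpha3 \<theta> p)\<^sup>2)"
  have G0: "G 0 > 0" by (rule G_pos) simp
  have "1 / G 0 > 0" using G0 by simp
  hence \<nu>: "\<nu> > 0" using assms by linarith
  have A: "A > 0" unfolding A_def by (rule alpha3_norm_pos)
  \<comment> \<open>Intermediate value theorem: \<open>G 0\<close> lies above 1 / \<nu>, and
    \<open>A * \<nu>\<close> is the point where the bound A / t of \<open>G_le\<close> has come down
    to 1 / \<nu>.\<close>
  have "\<exists>t\<ge>0. t \<le> A * \<nu> \<and> G t = 1 / \<nu>"
  proof (rule IVT2')
    have "G (A * \<nu>) \<le> A / (A * \<nu>)" unfolding A_def using \<nu> alpha3_norm_pos by (intro G_le mult_pos_pos)
    thus "G (A * \<nu>) \<le> 1 / \<nu>" using A by simp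
    show "1 / \<nu> \<le> G 0" using assms \<nu> G0 by (simp add: field_simps)
    show "0 \<le> A * \<nu>" using A \<nu> by simp
    show "continuous_on {0..A * \<nu>} G" by (rule continuous_on_subset[OF G_continuous]) auto
  qed
  then obtain t where t: "t \<ge> 0" "G t = 1 / \<nu>" by blast
  \<comment> \<open>Strictness of the coupling condition excludes a solution at the threshold
    itself.\<close>
  have "t \<noteq> 0" using t(2) assms \<nu> G0 by (auto simp: field_simps)
  hence "t \<in> zeros \<nu>" using t \<nu> by (simp add: zeros_def)
  hence "zeros \<nu> = {t}" using zeros_unique by blast
  thus ?thesis by simp
qed

end

section \<open>Eigenvalues in the two gaps\<close>

interpretation lower: dispersion E0 \<theta> for \<theta>
  by unfold_locales (auto simp: E0_bounds alpha3_le)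

interpretation upper: dispersion "\<lambda>p. 24 - E0 p" \<theta> for \<theta>
  by unfold_locales (auto simp: E0_bounds alpha3_le)

lemma G_0: "lower.G \<theta> 0 = a0 \<theta>" "upper.G \<theta> 0 = a0 \<theta>"
  using a0_reflect[of \<theta>] by (simp_all add: lower.G_def upper.G_def a0_def)

lemma of_real_continuum_iff: "complex_of_real x \<in> continuum \<longleftrightarrow> 0 \<le> x \<and> x \<le> 24"
  by (auto simp: continuum_def)

lemma eigenvalue_below_iff:
  assumes "t > 0"
  shows "eigenvalue (L2_sym \<theta>) (H \<theta> \<mu>) (of_real (- t)) \<longleftrightarrow> t \<in> lower.zeros \<theta> (- \<mu>)"
proof -
  have z: "complex_of_real (- t) \<notin> continuum" using assms by (simp only: of_real_continuum_iff) simp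
  have "eigenvalue (L2_sym \<theta>) (H \<theta> \<mu>) (of_real (- t)) \<longleftrightarrow> complex_of_real (1 + \<mu> * lower.G \<theta> t) = 0"
    unfolding eigenvalue_iff[OF z] resolvent_form_of_real by (simp add: lower.G_def)
  thus ?thesis using assms unfolding of_real_eq_0_iff lower.zeros_def by auto
qed

text \<open>Above the continuum \<open>E0 - (24 + t)\<close> is the negative of
  \<open>24 - E0 + t\<close>, so the sign of the coupling is reversed compared with the lower
  gap.\<close>

lemma eigenvalue_above_iff:
  assumes "t > 0"
  shows "eigenvalue (L2_sym \<theta>) (H \<theta> \<mu>) (of_real (24 + t)) \<longleftrightarrow> t \<in> upper.zeros \<theta> \<mu>"
proof -
  have z: "complex_of_real (24 + t) \<notin> continuum" using assms by (simp only: of_real_continuum_iff) simp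
  have F: "(LINT p|T3. (alpha3 \<theta> p)\<^sup>2 / (E0 p - (24 + t))) = - upper.G \<theta> t"
  proof -
    have "(alpha3 \<theta> p)\<^sup>2 / (E0 p - (24 + t)) = - ((alpha3 \<theta> p)\<^sup>2 / (24 - E0 p + t))" for p
      by (metis minus_divide_right minus_diff_eq diff_diff_eq2 diff_add_eq)
    thus ?thesis by (simp add: upper.G_def)
  qed
  have "eigenvalue (L2_sym \<theta>) (H \<theta> \<mu>) (of_real (24 + t)) \<longleftrightarrow> complex_of_real (1 + \<mu> * - upper.G \<theta> t) = 0"
    unfolding eigenvalue_iff[OF z] resolvent_form_of_real F by (simp only: of_real_add of_real_mult of_real_1)
  thus ?thesis using assms unfolding of_real_eq_0_iff upper.zeros_def by auto
qed

text \<open>Zeros of the determinant are real, so each lies in the lower or in the upper gap, and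
  each gap contributes only finitely many.\<close>

lemma essential_spectrum_eq: "essential_spectrum (L2_sym \<theta>) (H \<theta> \<mu>) = continuum"
proof (rule essential_spectrum_H)
  have "{z. z \<notin> continuum \<and> 1 + of_real \<mu> * resolvent_form \<theta> z = 0} \<subseteq>
      (\<lambda>t. of_real (- t)) ` lower.zeros \<theta> (- \<mu>) \<union> (\<lambda>t. of_real (24 + t)) ` upper.zeros \<theta> \<mu>"
  proof (rule subsetI, unfold mem_Collect_eq, elim conjE)
    fix z assume z: "z \<notin> continuum" "1 + of_real \<mu> * resolvent_form \<theta> z = 0"
    define x where "x = Re z"
    have zx: "z = of_real x" unfolding x_def by (rule zero_imp_real[OF z])
    have ev: "eigenvalue (L2_sym \<theta>) (H \<theta> \<mu>) (of_real x)" using eigenvalue_iff[OF z(1)] z(2) zx by simp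
    consider "x < 0" | "x > 24" using z(1) unfolding zx of_real_continuum_iff by linarith
    thus "z \<in> (\<lambda>t. of_real (- t)) ` lower.zeros \<theta> (- \<mu>) \<union> (\<lambda>t. of_real (24 + t)) ` upper.zeros \<theta> \<mu>"
    proof cases
      case 1
      hence "- x \<in> lower.zeros \<theta> (- \<mu>)" using eigenvalue_below_iff[of "- x" \<theta> \<mu>] ev by simp
      thus ?thesis unfolding zx by (intro UnI1 image_eqI[of _ _ "- x"]) auto
    next
      case 2
      hence "x - 24 \<in> upper.zeros \<theta> \<mu>" using eigenvalue_above_iff[of "x - 24" \<theta> \<mu>] ev by simp
      thus ?thesis unfolding zx by (intro UnI2 image_eqI[of _ _ "x - 24"]) auto
    qed
  qed
  thus "finite {z. z \<notin> continuum \<and> 1 + of_real \<mu> * resolvent_form \<theta> z = 0}"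
    by (rule finite_subset) (simp add: lower.finite_zeros upper.finite_zeros)
qed

lemma eigenvalues_below_eq:
  "eigenvalues_below (L2_sym \<theta>) (H \<theta> \<mu>) = uminus ` lower.zeros \<theta> (- \<mu>)"
proof -
  have "x \<in> eigenvalues_below (L2_sym \<theta>) (H \<theta> \<mu>) \<longleftrightarrow> x < 0 \<and> eigenvalue (L2_sym \<theta>) (H \<theta> \<mu>) (of_real x)" for x
    unfolding eigenvalues_below_def essential_spectrum_eq continuum_def by force
  moreover have "x \<in> uminus ` lower.zeros \<theta> (- \<mu>) \<longleftrightarrow> x < 0 \<and> - x \<in> lower.zeros \<theta> (- \<mu>)" for x
    by (auto simp: lower.zeros_def intro: image_eqI[of x uminus "- x"])
  moreover have "x < 0 \<and> - x \<in> lower.zeros \<theta> (- \<mu>) \<longleftrightarrow> x < 0 \<and> eigenvalue (L2_sym \<theta>) (H \<theta> \<mu>) (of_real x)" for x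
    using eigenvalue_below_iff[of "- x" \<theta> \<mu>] by auto
  ultimately show ?thesis by blast
qed

lemma eigenvalues_above_eq:
  "eigenvalues_above (L2_sym \<theta>) (H \<theta> \<mu>) = (+) 24 ` upper.zeros \<theta> \<mu>"
proof -
  have "x \<in> eigenvalues_above (L2_sym \<theta>) (H \<theta> \<mu>) \<longleftrightarrow> x > 24 \<and> eigenvalue (L2_sym \<theta>) (H \<theta> \<mu>) (of_real x)" for x
    unfolding eigenvalues_above_def essential_spectrum_eq continuum_def by force
  moreover have "x \<in> (+) 24 ` upper.zeros \<theta> \<mu> \<longleftrightarrow> x > 24 \<and> x - 24 \<in> upper.zeros \<theta> \<mu>" for x
    by (auto simp: upper.zeros_def intro: image_eqI[of x "(+) 24" "x - 24"])
  moreover have "x > 24 \<and> x - 24 \<in> upper.zeros \<theta> \<mu> \<longleftrightarrow> x > 24 \<and> eigenvalue (L2_sym \<theta>) (H \<theta> \<mu>) (of_real x)" for x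
    using eigenvalue_above_iff[of "x - 24" \<theta> \<mu>] by auto
  ultimately show ?thesis by blast
qed

theorem theorem4p4:
  fixes \<mu> :: real and \<zeta> :: nat and \<theta> :: symmetry
  assumes "\<zeta> \<in> {0, 1}"
  shows "essential_spectrum (L2_sym \<theta>) (H \<theta> \<mu>) = complex_of_real ` {0..24} \<and>
    (\<mu> \<in> B_minus \<theta> \<zeta> \<longrightarrow>
       finite (eigenvalues_below (L2_sym \<theta>) (H \<theta> \<mu>)) \<and>
       card (eigenvalues_below (L2_sym \<theta>) (H \<theta> \<mu>)) = \<zeta> \<and>
       (\<forall>z\<in>eigenvalues_below (L2_sym \<theta>) (H \<theta> \<mu>).
          has_dim (eigenspace (L2_sym \<theta>) (H \<theta> \<mu>) (of_real z)) 1 \<and>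
          (\<exists>c. eigenfunction (L2_sym \<theta>) (H \<theta> \<mu>) (of_real z) (eigenfun \<theta> \<mu> z c) \<and>
               norm_L2 (eigenfun \<theta> \<mu> z c) = 1))) \<and>
    (\<mu> \<in> B_plus \<theta> \<zeta> \<longrightarrow>
       finite (eigenvalues_above (L2_sym \<theta>) (H \<theta> \<mu>)) \<and>
       card (eigenvalues_above (L2_sym \<theta>) (H \<theta> \<mu>)) = \<zeta> \<and>
       (\<forall>z\<in>eigenvalues_above (L2_sym \<theta>) (H \<theta> \<mu>).
          has_dim (eigenspace (L2_sym \<theta>) (H \<theta> \<mu>) (of_real z)) 1 \<and>
          (\<exists>c. eigenfunction (L2_sym \<theta>) (H \<theta> \<mu>) (of_real z) (eigenfun \<theta> \<mu> z c) \<and>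
               norm_L2 (eigenfun \<theta> \<mu> z c) = 1)))"
proof -
  have eigen: "has_dim (eigenspace (L2_sym \<theta>) (H \<theta> \<mu>) (of_real z)) 1 \<and>
      (\<exists>c. eigenfunction (L2_sym \<theta>) (H \<theta> \<mu>) (of_real z) (eigenfun \<theta> \<mu> z c) \<and>
               norm_L2 (eigenfun \<theta> \<mu> z c) = 1)"
    if "eigenvalue (L2_sym \<theta>) (H \<theta> \<mu>) (of_real z)" "complex_of_real z \<notin> continuum" for z
    using eigenspace_dim_1[OF that(2,1)] eigenfun_normalized[OF that(2,1)] by blast
  have below: "eigenvalue (L2_sym \<theta>) (H \<theta> \<mu>) (of_real z)" "complex_of_real z \<notin> continuum"
    if "z \<in> eigenvalues_below (L2_sym \<theta>) (H \<theta> \<mu>)" for z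
    using that unfolding eigenvalues_below_def essential_spectrum_eq by auto
  have above: "eigenvalue (L2_sym \<theta>) (H \<theta> \<mu>) (of_real z)" "complex_of_real z \<notin> continuum"
    if "z \<in> eigenvalues_above (L2_sym \<theta>) (H \<theta> \<mu>)" for z
    using that unfolding eigenvalues_above_def essential_spectrum_eq by auto
  \<comment> \<open>By \<open>G_0\<close> the threshold 1 / G 0 is \<open>mu20\<close>, and
    comparing \<mu> with \<open>- mu20\<close> amounts to comparing -\<mu> with 1 / G 0.\<close>
  have "card (lower.zeros \<theta> (- \<mu>)) = \<zeta>" if "\<mu> \<in> B_minus \<theta> \<zeta>"
    using that assms lower.card_zeros_small[of "- \<mu>" \<theta>] lower.card_zeros_large[where \<nu> = "- \<mu>" and \<theta> = \<theta>]
    by (auto simp: B_minus_def mu20_def G_0)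
  hence card_below: "card (eigenvalues_below (L2_sym \<theta>) (H \<theta> \<mu>)) = \<zeta>" if "\<mu> \<in> B_minus \<theta> \<zeta>"
    using that by (simp add: eigenvalues_below_eq card_image)
  have "card (upper.zeros \<theta> \<mu>) = \<zeta>" if "\<mu> \<in> B_plus \<theta> \<zeta>"
    using that assms upper.card_zeros_small[where \<nu> = \<mu> and \<theta> = \<theta>] upper.card_zeros_large[where \<nu> = \<mu> and \<theta> = \<theta>]
    by (auto simp: B_plus_def mu20_def G_0)
  hence card_above: "card (eigenvalues_above (L2_sym \<theta>) (H \<theta> \<mu>)) = \<zeta>" if "\<mu> \<in> B_plus \<theta> \<zeta>"
    using that by (simp add: eigenvalues_above_eq card_image)
  have "finite (eigenvalues_below (L2_sym \<theta>) (H \<theta> \<mu>))" "finite (eigenvalues_above (L2_sym \<theta>) (H \<theta> \<mu>))"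
    by (simp_all add: eigenvalues_below_eq eigenvalues_above_eq lower.finite_zeros upper.finite_zeros)
  thus ?thesis
    using card_below card_above eigen below above
    by (simp add: essential_spectrum_eq continuum_def[symmetric])
qed

end
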